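(* A reality preserving embedding (injective Lie algebra homomorphism) of the Lie algebra $\mathfrak{u}(2,\mathbb{H})$ into $\mathcal{W}^\hbar=\mathcal{W}(\mathfrak{heis}_3)[\sqrt\hbar^{\,-1},\sqrt\hbar]]$ (with commutator bracket) is given by $$J^{\alpha\beta}\mapsto\mathcal{J}^{\alpha\beta},\qquad P^\alpha_{\dot\alpha}\mapsto\mathcal{P}^\alpha_{\dot\alpha},\qquad K_{\dot\alpha\dot\beta}\mapsto\mathcal{K}_{\dot\alpha\dot\beta},$$ where $$\mathcal{K}_{\dot+\dot+}=-2i\sqrt{\tfrac1\hbar-N-\tfrac n2}\;a,\qquad \mathcal{K}_{\dot+\dot-}=\mathcal{K}_{\dot-\dot+}=i\left(\tfrac1\hbar-N-n\right),\qquad \mathcal{K}_{\dot-\dot-}=2i\,a^\dagger\sqrt{\tfrac1\hbar-N-\tfrac n2},$$ $$\mathcal{P}^+_{\dot+}=-a^+_{\dot-}a+\sqrt{\tfrac1\hbar-N-\tfrac n2}\;a^+_{\dot+},\qquad \mathcal{P}^-_{\dot-}=a^\dagger a^-_{\dot+}+a^-_{\dot-}\sqrt{\tfrac1\hbar-N-\tfrac n2},$$ $$\mathcal{P}^+_{\dot-}=a^\dagger a^+_{\dot+}+a^+_{\dot-}\sqrt{\tfrac1\hbar-N-\tfrac n2},\qquad \mathcal{P}^-_{\dot+}=-a^-_{\dot-}a+\sqrt{\tfrac1\hbar-N-\tfrac n2}\;a^-_{\dot+},$$ $$\mathcal{J}^{++}=-2i\,a^+_{\dot-}a^+_{\dot+},\qquad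 \mathcal{J}^{+-}=\mathcal{J}^{-+}=-i\left(a^+_{\dot+}a^-_{\dot-}+a^-_{\dot+}a^+_{\dot-}\right),\qquad \mathcal{J}^{--}=-2i\,a^-_{\dot+}a^-_{\dot-}.$$
   Context: **The Lie algebra.** $\mathfrak{u}(2,\mathbb{H})$ is the 10-dimensional real Lie algebra of quaternionic antihermitean $2\times2$ matrices, with real basis ($e_1,e_2,e_3$ the quaternionic units $\mathbf{i},\mathbf{j},\mathbf{k}$) $$j_i=\tfrac12\begin{pmatrix}e_i&0\\0&0\end{pmatrix},\quad p_0=\tfrac12\begin{pmatrix}0&1\\-1&0\end{pmatrix},\quad p_i=\tfrac12\begin{pmatrix}0&e_i\\ e_i&0\end{pmatrix},\quad k_i=\tfrac12\begin{pmatrix}0&0\\0&e_i\end{pmatrix}\quad(i=1,2,3).$$ It is a real form of $\mathfrak{sp}(4,\mathbb{C})=\mathfrak{u}(2,\mathbb{H})\otimes\mathbb{C}$, which has the complex basis $J^{++}=2(-j_1+ij_2)$, $J^{+-}=J^{-+}=-2j_3$, $J^{--}=2(j_1+ij_2)$; $P^+_{\dot+}=-p_3-ip_0$, $P^+_{\dot-}=-p_1+ip_2$, $P^-_{\dot+}=p_1+ip_2$, $P^-_{\dot-}=-p_3+ip_0$; $K_{\dot+\dot+}=2(k_1+ik_2)$, $K_{\dot+\dot-}=K_{\dot-\dot+}=-2k_3$, $K_{\dot-\dot-}=2(-k_1+ik_2)$. The embedding is specified on this basis and extended complex linearly to $\mathfrak{sp}(4,\mathbb{C})$. Let $\dagger$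 be the conjugate linear involution of $\mathfrak{sp}(4,\mathbb{C})$ with $X^\dagger=-X$ for $X\in\mathfrak{u}(2,\mathbb{H})$; thus $(J^{++})^\dagger=J^{--}$, $(J^{+-})^\dagger=-J^{+-}$, $(P^+_{\dot+})^\dagger=-P^-_{\dot-}$, $(P^+_{\dot-})^\dagger=P^-_{\dot+}$, $(K_{\dot+\dot+})^\dagger=K_{\dot-\dot-}$, $(K_{\dot+\dot-})^\dagger=-K_{\dot+\dot-}$, and $\mathfrak{u}(2,\mathbb{H})$ is the fixed point set of the conjugate linear Lie algebra automorphism $X\mapsto-X^\dagger$. **Weyl algebra.** $\mathcal{W}(\mathfrak{heis}_3)$ is the unital associative $\mathbb{C}$-algebra generated by $a,a^\dagger,a^\alpha_{\dot\alpha}$ ($\alpha\in\{+,-\}$, $\dot\alpha\in\{\dot+,\dot-\}$) with relations $[a,a^\dagger]=1$, $[a^\alpha_{\dot\alpha},a^\beta_{\dot\beta}]=-\epsilon^{\alpha\beta}\eta_{\dot\alpha\dot\beta}$, and all $a,a^\dagger$ commuting with all $a^\alpha_{\dot\alpha}$. Here $\epsilon^{+-}=1=-\epsilon^{-+}$, $\epsilon^{++}=\epsilon^{--}=0$, $\eta_{\dot+\dot-}=\eta_{\dot-\dot+}=1$, $\eta_{\dot+\dot+}=\eta_{\dot-\dot-}=0$. It carries the conjugate linear involution $\dagger$ with $(xy)^\dagger=y^\dagger x^\dagger$, $(a)^\dagger=a^\dagger$, $(a^+_{\dot+})^\dagger=-a^-_{\dot-}$, $(a^+_{\dot-})^\dagger=a^-_{\dot+}$.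 Set $$n=2a^\dagger a,\qquad N=a^+_{\dot-}a^-_{\dot+}-a^+_{\dot+}a^-_{\dot-}.$$ $\mathcal{W}^\hbar$ is the algebra of formal Laurent series $\sum_{k\ge M}w_k\sqrt\hbar^{\,k}$, $M\in\mathbb{Z}$, $w_k\in\mathcal{W}(\mathfrak{heis}_3)$, in the central indeterminate $\sqrt\hbar$, with $\sqrt\hbar^{\,\dagger}=\sqrt\hbar$. The square root denotes the element $$\sqrt{\tfrac1\hbar-N-\tfrac n2}:=\frac1{\sqrt\hbar}\sum_{k=0}^\infty(-1)^k\frac{\prod_{l=0}^{k-1}(1-2l)}{2^kk!}\Big(N+\frac n2\Big)^k\hbar^k\in\mathcal{W}^\hbar .$$ **Reality preserving.** An embedding $\phi$ is reality preserving if it intertwines the conjugate linear involutive Lie algebra automorphisms $X\mapsto-X^\dagger$ of source and target, i.e. $\phi(X^\dagger)=\phi(X)^\dagger$ for all $X$. *)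

theory Defs
  imports
    "HOL-Analysis.Analysis"
    "HOL-Library.Poly_Mapping"
    "HOL-Computational_Algebra.Formal_Laurent_Series"
begin

section \<open>The Lie algebra of quaternionic antihermitean matrices\<close>

subsection \<open>Quaternions\<close>

datatype quat = Quat (quat_re: real) (quat_i: real) (quat_j: real) (quat_k: real)

instantiation quat :: ring_1
begin

definition zero_quat :: quat where "0 = Quat 0 0 0 0"

definition one_quat :: quat where "1 = Quat 1 0 0 0"

fun plus_quat :: "quat \<Rightarrow> quat \<Rightarrow> quat" where
  "Quat a b c d + Quat a' b' c' d' = Quat (a + a') (b + b') (c + c') (d + d')"

fun uminus_quat :: "quat \<Rightarrow> quat" where
  "- Quat a b c d = Quat (- a) (- b) (- c) (- d)"

definition minus_quat :: "quat \<Rightarrow> quat \<Rightarrow> quat" where "x - y = x + - (y :: quat)"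

fun times_quat :: "quat \<Rightarrow> quat \<Rightarrow> quat" where
  "Quat a b c d * Quat a' b' c' d' =
     Quat (a * a' - b * b' - c * c' - d * d')
          (a * b' + b * a' + c * d' - d * c')
          (a * c' - b * d' + c * a' + d * b')
          (a * d' + b * c' - c * b' + d * a')"

instance
proof
  fix x y z :: quat
  show "x + y + z = x + (y + z)" by (cases x; cases y; cases z) simp
  show "x + y = y + x" by (cases x; cases y) simp
  show "0 + x = x" by (cases x) (simp add: zero_quat_def)
  show "- x + x = 0" by (cases x) (simp add: zero_quat_def)
  show "x - y = x + - y" by (simp add: minus_quat_def)
  show "x * y * z = x * (y * z)"
    by (cases x; cases y; cases z) (simp add: algebra_simps)
  show "(x + y) * z = x * z + y * z"
    by (cases x; cases y; cases z) (simp add: algebra_simps)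
  show "x * (y + z) = x * y + x * z"
    by (cases x; cases y; cases z) (simp add: algebra_simps)
  show "1 * x = x" by (cases x) (simp add: one_quat_def)
  show "x * 1 = x" by (cases x) (simp add: one_quat_def)
  show "(0 :: quat) \<noteq> 1" by (simp add: zero_quat_def one_quat_def)
qed

end

instantiation quat :: real_algebra_1
begin

fun scaleR_quat :: "real \<Rightarrow> quat \<Rightarrow> quat" where
  "r *\<^sub>R Quat a b c d = Quat (r * a) (r * b) (r * c) (r * d)"

instance
proof
  fix x y :: quat and r s :: real
  show "r *\<^sub>R (x + y) = r *\<^sub>R x + r *\<^sub>R y" by (cases x; cases y) (simp add: algebra_simps)
  show "(r + s) *\<^sub>R x = r *\<^sub>R x + s *\<^sub>R x" by (cases x) (simp add: algebra_simps)
  show "r *\<^sub>R s *\<^sub>R x = (r * s) *\<^sub>R x" by (cases x) simp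
  show "1 *\<^sub>R x = x" by (cases x) simp
  show "r *\<^sub>R x * y = r *\<^sub>R (x * y)" by (cases x; cases y) (simp add: algebra_simps)
  show "x * r *\<^sub>R y = r *\<^sub>R (x * y)" by (cases x; cases y) (simp add: algebra_simps)
qed

end

fun quat_cnj :: "quat \<Rightarrow> quat" where
  "quat_cnj (Quat a b c d) = Quat a (- b) (- c) (- d)"

datatype axis = Ax1 | Ax2 | Ax3

primrec quat_unit :: "axis \<Rightarrow> quat" where
  "quat_unit Ax1 = Quat 0 1 0 0"
| "quat_unit Ax2 = Quat 0 0 1 0"
| "quat_unit Ax3 = Quat 0 0 0 1"

lemma quat_cnj_simps [simp]:
  "quat_cnj 0 = 0" "quat_cnj 1 = 1"
  "quat_cnj (x + y) = quat_cnj x + quat_cnj y"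
  "quat_cnj (- x) = - quat_cnj x"
  "quat_cnj (x - y) = quat_cnj x - quat_cnj y"
  "quat_cnj (x * y) = quat_cnj y * quat_cnj x"
  "quat_cnj (r *\<^sub>R x) = r *\<^sub>R quat_cnj x"
  "quat_cnj (quat_cnj x) = x"
  "quat_cnj (quat_unit e) = - quat_unit e"
  by (cases x; cases y; cases e; simp add: zero_quat_def one_quat_def minus_quat_def)+

lemma quat_cnj_sum: "quat_cnj (sum f A) = (\<Sum>i\<in>A. quat_cnj (f i))"
  by (induction A rule: infinite_finite_induct) simp_all

subsection \<open>The real Lie algebra \<open>u(2,H)\<close>\<close>

definition adjoint_mat :: "quat^2^2 \<Rightarrow> quat^2^2" where
  "adjoint_mat A = (\<chi> i j. quat_cnj (A $ j $ i))"

lemma adjoint_mat_simps [simp]: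
  "adjoint_mat 0 = 0"
  "adjoint_mat (A + B) = adjoint_mat A + adjoint_mat B"
  "adjoint_mat (A - B) = adjoint_mat A - adjoint_mat B"
  "adjoint_mat (- A) = - adjoint_mat A"
  "adjoint_mat (r *\<^sub>R A) = r *\<^sub>R adjoint_mat A"
  by (simp_all add: adjoint_mat_def vec_eq_iff)

lemma adjoint_mat_mult: "adjoint_mat (A ** B) = adjoint_mat B ** adjoint_mat A"
  by (simp add: adjoint_mat_def matrix_matrix_mult_def vec_eq_iff quat_cnj_sum)

lemma matrix_mult_minus [simp]:
  fixes A B :: "quat^2^2"
  shows "(- A) ** B = - (A ** B)" "A ** (- B) = - (A ** B)"
  by (simp_all add: matrix_matrix_mult_def vec_eq_iff sum_negf)

typedef u2H = "{A :: quat^2^2. adjoint_mat A = - A}"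
  by (rule exI[of _ 0]) simp

setup_lifting type_definition_u2H

instantiation u2H :: real_vector
begin

lift_definition zero_u2H :: u2H is 0 by simp
lift_definition plus_u2H :: "u2H \<Rightarrow> u2H \<Rightarrow> u2H" is "(+)" by simp
lift_definition minus_u2H :: "u2H \<Rightarrow> u2H \<Rightarrow> u2H" is "(-)" by simp
lift_definition uminus_u2H :: "u2H \<Rightarrow> u2H" is uminus by simp
lift_definition scaleR_u2H :: "real \<Rightarrow> u2H \<Rightarrow> u2H" is scaleR by simp

instance
  by (standard; transfer) (simp_all add: algebra_simps)

end

lift_definition u2H_bracket :: "u2H \<Rightarrow> u2H \<Rightarrow> u2H" is "\<lambda>A B. A ** B - B ** A"
  by (simp add: adjoint_mat_mult)

definition mat2 :: "quat \<Rightarrow> quat \<Rightarrow> quat \<Rightarrow> quat \<Rightarrow> quat^2^2" where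
  "mat2 a b c d = vector [vector [a, b], vector [c, d]]"

lemma adjoint_mat2:
  "adjoint_mat (mat2 a b c d) = mat2 (quat_cnj a) (quat_cnj c) (quat_cnj b) (quat_cnj d)"
  by (simp add: adjoint_mat_def mat2_def vec_eq_iff forall_2)

lemma minus_mat2: "- mat2 a b c d = mat2 (- a) (- b) (- c) (- d)"
  by (simp add: mat2_def vec_eq_iff forall_2)

lift_definition u2H_j :: "axis \<Rightarrow> u2H" is "\<lambda>i. (1/2) *\<^sub>R mat2 (quat_unit i) 0 0 0"
  by (simp add: adjoint_mat2 minus_mat2 flip: scaleR_minus_right)

lift_definition u2H_p0 :: u2H is "(1/2) *\<^sub>R mat2 0 1 (- 1) 0"
  by (simp add: adjoint_mat2 minus_mat2 flip: scaleR_minus_right)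

lift_definition u2H_p :: "axis \<Rightarrow> u2H" is "\<lambda>i. (1/2) *\<^sub>R mat2 0 (quat_unit i) (quat_unit i) 0"
  by (simp add: adjoint_mat2 minus_mat2 flip: scaleR_minus_right)

lift_definition u2H_k :: "axis \<Rightarrow> u2H" is "\<lambda>i. (1/2) *\<^sub>R mat2 0 0 0 (quat_unit i)"
  by (simp add: adjoint_mat2 minus_mat2 flip: scaleR_minus_right)

subsection \<open>Its complexification \<open>sp(4,C)\<close>\<close>

text \<open>\<open>Cx X Y\<close> stands for \<open>X \<otimes> 1 + Y \<otimes> i\<close>.\<close>

datatype 'a complexified = Cx (cx_re: 'a) (cx_im: 'a)

instantiation complexified :: (ab_group_add) ab_group_add
begin

definition zero_complexified :: "'a complexified" where "0 = Cx 0 0"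

definition plus_complexified :: "'a complexified \<Rightarrow> 'a complexified \<Rightarrow> 'a complexified" where
  "z + w = Cx (cx_re z + cx_re w) (cx_im z + cx_im w)"

definition minus_complexified :: "'a complexified \<Rightarrow> 'a complexified \<Rightarrow> 'a complexified" where
  "z - w = Cx (cx_re z - cx_re w) (cx_im z - cx_im w)"

definition uminus_complexified :: "'a complexified \<Rightarrow> 'a complexified" where
  "- z = Cx (- cx_re z) (- cx_im z)"

instance
  by standard (simp_all add: zero_complexified_def plus_complexified_def
      minus_complexified_def uminus_complexified_def add.assoc add.commute)

end

definition scaleC :: "complex \<Rightarrow> 'a::real_vector complexified \<Rightarrow> 'a complexified" where
  "scaleC c z = Cx (Re c *\<^sub>R cx_re z - Im c *\<^sub>R cx_im z) (Re c *\<^sub>R cx_im z + Im c *\<^sub>R cx_re z)"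

type_synonym sp4 = "u2H complexified"

text \<open>The complex bilinear extension of \<^const>\<open>u2H_bracket\<close>.\<close>

definition sp4_bracket :: "sp4 \<Rightarrow> sp4 \<Rightarrow> sp4" where
  "sp4_bracket z w =
     Cx (u2H_bracket (cx_re z) (cx_re w) - u2H_bracket (cx_im z) (cx_im w))
        (u2H_bracket (cx_re z) (cx_im w) + u2H_bracket (cx_im z) (cx_re w))"

definition of_u2H :: "u2H \<Rightarrow> sp4" where
  "of_u2H X = Cx X 0"

text \<open>The conjugate linear map which is \<open>-X\<close> on \<open>u(2,H)\<close>:
  \<open>(X + iY)\<^sup>\<dagger> = -X + iY\<close>.\<close>

definition sp4_dagger :: "sp4 \<Rightarrow> sp4" where
  "sp4_dagger z = Cx (- cx_re z) (cx_im z)"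

text \<open>Undotted and dotted indices.\<close>

datatype idx = Pl | Mi
datatype didx = DPl | DMi

fun sp4_J :: "idx \<Rightarrow> idx \<Rightarrow> sp4" where
  "sp4_J Pl Pl = scaleC 2 (- of_u2H (u2H_j Ax1) + scaleC \<i> (of_u2H (u2H_j Ax2)))"
| "sp4_J Pl Mi = scaleC (- 2) (of_u2H (u2H_j Ax3))"
| "sp4_J Mi Pl = scaleC (- 2) (of_u2H (u2H_j Ax3))"
| "sp4_J Mi Mi = scaleC 2 (of_u2H (u2H_j Ax1) + scaleC \<i> (of_u2H (u2H_j Ax2)))"

fun sp4_P :: "idx \<Rightarrow> didx \<Rightarrow> sp4" where
  "sp4_P Pl DPl = - of_u2H (u2H_p Ax3) - scaleC \<i> (of_u2H u2H_p0)"
| "sp4_P Pl DMi = - of_u2H (u2H_p Ax1) + scaleC \<i> (of_u2H (u2H_p Ax2))"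
| "sp4_P Mi DPl = of_u2H (u2H_p Ax1) + scaleC \<i> (of_u2H (u2H_p Ax2))"
| "sp4_P Mi DMi = - of_u2H (u2H_p Ax3) + scaleC \<i> (of_u2H u2H_p0)"

fun sp4_K :: "didx \<Rightarrow> didx \<Rightarrow> sp4" where
  "sp4_K DPl DPl = scaleC 2 (of_u2H (u2H_k Ax1) + scaleC \<i> (of_u2H (u2H_k Ax2)))"
| "sp4_K DPl DMi = scaleC (- 2) (of_u2H (u2H_k Ax3))"
| "sp4_K DMi DPl = scaleC (- 2) (of_u2H (u2H_k Ax3))"
| "sp4_K DMi DMi = scaleC 2 (- of_u2H (u2H_k Ax1) + scaleC \<i> (of_u2H (u2H_k Ax2)))"

lemma sp4_dagger_of_u2H: "sp4_dagger (of_u2H X) = - of_u2H X"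
  by (simp add: sp4_dagger_def of_u2H_def uminus_complexified_def)

lemma sp4_dagger_add: "sp4_dagger (z + w) = sp4_dagger z + sp4_dagger w"
  by (simp add: sp4_dagger_def plus_complexified_def)

lemma sp4_dagger_scaleC: "sp4_dagger (scaleC c z) = scaleC (cnj c) (sp4_dagger z)"
  by (simp add: sp4_dagger_def scaleC_def)

section \<open>The Weyl algebra\<close>

definition commutator :: "'a::ring \<Rightarrow> 'a \<Rightarrow> 'a" where
  "commutator x y = x * y - y * x"

subsection \<open>The free associative algebra on the generators\<close>

text \<open>The convolution product of \<^theory>\<open>HOL-Library.Poly_Mapping\<close> expects an additively
  written monoid of exponents; here it is the (noncommutative) monoid of words under
  concatenation, so that \<open>'g free_word \<Rightarrow>\<^sub>0 complex\<close> is the free associative algebra.\<close>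

datatype 'g free_word = Word (letters: "'g list")

instantiation free_word :: (type) monoid_add
begin

definition zero_free_word :: "'a free_word" where "0 = Word []"

definition plus_free_word :: "'a free_word \<Rightarrow> 'a free_word \<Rightarrow> 'a free_word" where
  "u + v = Word (letters u @ letters v)"

instance
  by standard (simp_all add: zero_free_word_def plus_free_word_def)

end

text \<open>The generators \<open>a\<close>, \<open>a\<^sup>\<dagger>\<close> and \<open>a\<^sup>\<alpha>\<^bsub>\<alpha>'\<^esub>\<close>, the latter with one undotted and one dotted index.\<close>

datatype weyl_gen = GenA | GenAdag | GenAA idx didx

type_synonym free_alg = "weyl_gen free_word \<Rightarrow>\<^sub>0 complex"

definition free_gen :: "weyl_gen \<Rightarrow> free_alg" where
  "free_gen g = Poly_Mapping.single (Word [g]) 1"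

definition free_scale :: "complex \<Rightarrow> free_alg \<Rightarrow> free_alg" where
  "free_scale c x = Poly_Mapping.single 0 c * x"

fun eps :: "idx \<Rightarrow> idx \<Rightarrow> complex" where
  "eps Pl Mi = 1"
| "eps Mi Pl = - 1"
| "eps Pl Pl = 0"
| "eps Mi Mi = 0"

fun eta :: "didx \<Rightarrow> didx \<Rightarrow> complex" where
  "eta DPl DMi = 1"
| "eta DMi DPl = 1"
| "eta DPl DPl = 0"
| "eta DMi DMi = 0"

inductive_set weyl_ideal :: "free_alg set" where
  rel_a: "commutator (free_gen GenA) (free_gen GenAdag) - 1 \<in> weyl_ideal"
| rel_aa: "commutator (free_gen (GenAA \<alpha> \<alpha>')) (free_gen (GenAA \<beta> \<beta>'))
    - free_scale (- eps \<alpha> \<beta> * eta \<alpha>' \<beta>') 1 \<in> weyl_ideal"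
| rel_a_aa: "commutator (free_gen GenA) (free_gen (GenAA \<alpha> \<alpha>')) \<in> weyl_ideal"
| rel_adag_aa: "commutator (free_gen GenAdag) (free_gen (GenAA \<alpha> \<alpha>')) \<in> weyl_ideal"
| zero: "0 \<in> weyl_ideal"
| add: "x \<in> weyl_ideal \<Longrightarrow> y \<in> weyl_ideal \<Longrightarrow> x + y \<in> weyl_ideal"
| mult_left: "x \<in> weyl_ideal \<Longrightarrow> y * x \<in> weyl_ideal"
| mult_right: "x \<in> weyl_ideal \<Longrightarrow> x * y \<in> weyl_ideal"

lemma weyl_ideal_uminus: "x \<in> weyl_ideal \<Longrightarrow> - x \<in> weyl_ideal"
  using weyl_ideal.mult_left[of x "- 1"] by simp

lemma weyl_ideal_diff: "x \<in> weyl_ideal \<Longrightarrow> y \<in> weyl_ideal \<Longrightarrow> x - y \<in> weyl_ideal"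
  using weyl_ideal.add[OF _ weyl_ideal_uminus] by fastforce

lemma free_scale_simps [simp]:
  "free_scale c 0 = 0"
  "free_scale c (x + y) = free_scale c x + free_scale c y"
  "free_scale c (x - y) = free_scale c x - free_scale c y"
  by (simp_all add: free_scale_def algebra_simps)

lemma single_0_central: "Poly_Mapping.single 0 c * x = x * Poly_Mapping.single 0 (c :: complex)"
  for x :: free_alg
proof (induction x rule: update_induct)
  case const
  show ?case by simp
next
  case (update f a b)
  have "Poly_Mapping.update a b f = f + Poly_Mapping.single a b"
    using update.hyps
    by (intro poly_mapping_eqI)
       (auto simp: lookup_update lookup_add lookup_single when_def in_keys_iff)
  then show ?case using update.IH
    by (simp add: algebra_simps mult_single)
qed

subsection \<open>The involution of the free algebra\<close>

text \<open>The conjugate linear antimultiplicative extension of the prescription on the generators.\<close>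

fun gen_dagger :: "weyl_gen \<Rightarrow> free_alg" where
  "gen_dagger GenA = free_gen GenAdag"
| "gen_dagger GenAdag = free_gen GenA"
| "gen_dagger (GenAA Pl DPl) = - free_gen (GenAA Mi DMi)"
| "gen_dagger (GenAA Mi DMi) = - free_gen (GenAA Pl DPl)"
| "gen_dagger (GenAA Pl DMi) = free_gen (GenAA Mi DPl)"
| "gen_dagger (GenAA Mi DPl) = free_gen (GenAA Pl DMi)"

definition word_dagger :: "weyl_gen free_word \<Rightarrow> free_alg" where
  "word_dagger w = prod_list (map gen_dagger (rev (letters w)))"

definition free_dagger :: "free_alg \<Rightarrow> free_alg" where
  "free_dagger x = (\<Sum>w\<in>Poly_Mapping.keys x. free_scale (cnj (Poly_Mapping.lookup x w)) (word_dagger w))"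

lemma free_dagger_superset:
  assumes "finite S" "Poly_Mapping.keys x \<subseteq> S"
  shows "free_dagger x = (\<Sum>w\<in>S. free_scale (cnj (Poly_Mapping.lookup x w)) (word_dagger w))"
  unfolding free_dagger_def
  by (rule sum.mono_neutral_left) (use assms in \<open>auto simp: in_keys_iff free_scale_def\<close>)

lemma free_dagger_add [simp]: "free_dagger (x + y) = free_dagger x + free_dagger y"
proof -
  let ?S = "Poly_Mapping.keys x \<union> Poly_Mapping.keys y"
  have "Poly_Mapping.keys (x + y) \<subseteq> ?S" by (rule Poly_Mapping.keys_add)
  then show ?thesis
    by (simp add: free_dagger_superset[of ?S] lookup_add free_scale_def single_add
        algebra_simps sum.distrib)
qed

lemma free_dagger_single:
  "free_dagger (Poly_Mapping.single w c) = free_scale (cnj c) (word_dagger w)"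
  by (subst free_dagger_superset[of "{w}"]) auto

lemma free_dagger_0 [simp]: "free_dagger 0 = 0"
  by (simp add: free_dagger_def)

lemma word_dagger_0 [simp]: "word_dagger 0 = 1"
  by (simp add: word_dagger_def zero_free_word_def)

lemma free_scale_1 [simp]: "free_scale 1 x = x"
  by (simp add: free_scale_def)

lemma free_dagger_1 [simp]: "free_dagger 1 = 1"
  using free_dagger_single[of 0 1] by simp

lemma free_dagger_uminus [simp]: "free_dagger (- x) = - free_dagger x"
  using free_dagger_add[of x "- x"] by (simp add: eq_neg_iff_add_eq_0 add.commute del: free_dagger_add)

lemma free_dagger_diff [simp]: "free_dagger (x - y) = free_dagger x - free_dagger y"
  using free_dagger_add[of x "- y"] by simp

lemma word_dagger_add: "word_dagger (u + v) = word_dagger v * word_dagger u"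
  by (simp add: word_dagger_def plus_free_word_def)

lemma free_alg_induct [case_names zero single_add]:
  fixes x :: free_alg
  assumes "P 0" and "\<And>w c x. P x \<Longrightarrow> P (Poly_Mapping.single w c + x)"
  shows "P x"
proof (induction x rule: update_induct)
  case const
  show ?case by (rule assms)
next
  case (update f a b)
  have "Poly_Mapping.update a b f = Poly_Mapping.single a b + f"
    using update.hyps
    by (intro poly_mapping_eqI)
       (auto simp: lookup_update lookup_add lookup_single when_def in_keys_iff)
  then show ?case using assms(2)[OF update.IH] by simp
qed

lemma free_dagger_mult_single:
  "free_dagger (Poly_Mapping.single u b * Poly_Mapping.single v c) =
     free_dagger (Poly_Mapping.single v c) * free_dagger (Poly_Mapping.single u b)"
proof -
  have "Poly_Mapping.single 0 (cnj c) * word_dagger v *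
        (Poly_Mapping.single 0 (cnj b) * word_dagger u) =
        Poly_Mapping.single 0 (cnj c) * (word_dagger v *
        Poly_Mapping.single 0 (cnj b)) * word_dagger u"
    by (simp add: mult.assoc)
  also have "\<dots> = Poly_Mapping.single 0 (cnj c) * (Poly_Mapping.single 0 (cnj b) * word_dagger v) * word_dagger u"
    by (simp only: single_0_central)
  also have "\<dots> = Poly_Mapping.single 0 (cnj c * cnj b) * (word_dagger v * word_dagger u)"
    by (simp add: mult.assoc[symmetric] mult_single)
  finally show ?thesis
    by (simp add: mult_single free_dagger_single free_scale_def word_dagger_add mult.commute)
qed

lemma free_dagger_mult [simp]: "free_dagger (x * y) = free_dagger y * free_dagger x"
proof (induction x rule: free_alg_induct)
  case (single_add w c x)
  have "free_dagger (Poly_Mapping.single w c * y) =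
        free_dagger y * free_dagger (Poly_Mapping.single w c)"
    by (induction y rule: free_alg_induct) (simp_all add: algebra_simps free_dagger_mult_single)
  with single_add show ?case by (simp add: algebra_simps)
qed simp

lemma free_dagger_gen [simp]: "free_dagger (free_gen g) = gen_dagger g"
  by (simp add: free_gen_def free_dagger_single word_dagger_def free_scale_def)

lemma free_dagger_single_0 [simp]:
  "free_dagger (Poly_Mapping.single 0 c) = Poly_Mapping.single 0 (cnj c)"
  by (simp add: free_dagger_single free_scale_def)

lemma free_dagger_scale [simp]: "free_dagger (free_scale c x) = free_scale (cnj c) (free_dagger x)"
  by (simp add: free_scale_def single_0_central)

lemma free_dagger_commutator [simp]:
  "free_dagger (commutator x y) = commutator (free_dagger y) (free_dagger x)"
  by (simp add: commutator_def)

lemma commutator_uminus [simp]: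
  "commutator (- x) y = - commutator x y" "commutator x (- y) = - commutator x y"
  by (simp_all add: commutator_def)

lemma free_dagger_ideal: "x \<in> weyl_ideal \<Longrightarrow> free_dagger x \<in> weyl_ideal"
proof (induction rule: weyl_ideal.induct)
  case rel_a
  show ?case by (simp add: weyl_ideal.rel_a)
next
  case (rel_aa \<alpha> \<alpha>' \<beta> \<beta>')
  have swap: "commutator (free_gen (GenAA \<gamma> \<gamma>')) (free_gen (GenAA \<delta> \<delta>'))
      - free_scale (- eps \<gamma> \<delta> * eta \<gamma>' \<delta>') 1 \<in> weyl_ideal" for \<gamma> \<gamma>' \<delta> \<delta>'
    by (rule weyl_ideal.rel_aa)
  have neg: "- commutator (free_gen (GenAA \<gamma> \<gamma>')) (free_gen (GenAA \<delta> \<delta>'))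
      \<in> weyl_ideal" if "eps \<gamma> \<delta> * eta \<gamma>' \<delta>' = 0" for \<gamma> \<gamma>' \<delta> \<delta>'
    using weyl_ideal_uminus[OF swap[of \<gamma> \<gamma>' \<delta> \<delta>']] that by (simp add: free_scale_def)
  have pos: "commutator (free_gen (GenAA \<gamma> \<gamma>')) (free_gen (GenAA \<delta> \<delta>'))
      \<in> weyl_ideal" if "eps \<gamma> \<delta> * eta \<gamma>' \<delta>' = 0" for \<gamma> \<gamma>' \<delta> \<delta>'
    using swap[of \<gamma> \<gamma>' \<delta> \<delta>'] that by (simp add: free_scale_def)
  show ?case
    by (cases \<alpha>; cases \<alpha>'; cases \<beta>; cases \<beta>')
       (auto intro: neg pos swap[of Mi DMi Pl DPl, unfolded free_scale_def, simplified] swap[of Pl DPl Mi DMi, unfolded free_scale_def, simplified]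
         swap[of Mi DPl Pl DMi, unfolded free_scale_def, simplified] swap[of Pl DMi Mi DPl, unfolded free_scale_def, simplified]
         simp: free_scale_def)
next
  case (rel_a_aa \<alpha> \<alpha>')
  have "commutator x y \<in> weyl_ideal" if "commutator y x \<in> weyl_ideal" for x y
    using weyl_ideal_uminus[OF that] by (simp add: commutator_def)
  then show ?case
    by (cases \<alpha>; cases \<alpha>') (auto intro!: weyl_ideal_uminus weyl_ideal.rel_adag_aa)
next
  case (rel_adag_aa \<alpha> \<alpha>')
  have "commutator x y \<in> weyl_ideal" if "commutator y x \<in> weyl_ideal" for x y
    using weyl_ideal_uminus[OF that] by (simp add: commutator_def)
  then show ?case
    by (cases \<alpha>; cases \<alpha>') (auto intro!: weyl_ideal_uminus weyl_ideal.rel_a_aa)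
qed (auto intro: weyl_ideal.intros)

subsection \<open>The quotient\<close>

quotient_type weyl = free_alg / "\<lambda>x y. x - y \<in> weyl_ideal"
proof (rule equivpI)
  show "reflp (\<lambda>x y. x - y \<in> weyl_ideal)"
    by (rule reflpI) (simp add: weyl_ideal.zero)
  show "symp (\<lambda>x y. x - y \<in> weyl_ideal)"
    by (rule sympI) (metis minus_diff_eq weyl_ideal_uminus)
  show "transp (\<lambda>x y. x - y \<in> weyl_ideal)"
    by (rule transpI) (metis diff_add_cancel add_diff_eq weyl_ideal.add)
qed

text \<open>The quotient is nonzero: realise \<open>a\<close>, \<open>a\<^sup>\<dagger>\<close>, \dots by differentiation and multiplication
  operators on formal power series in three commuting variables.\<close>

type_synonym fock = "nat \<Rightarrow> nat \<Rightarrow> nat \<Rightarrow> complex"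

fun gen_op :: "weyl_gen \<Rightarrow> fock \<Rightarrow> fock" where
  "gen_op GenA f = (\<lambda>m p q. of_nat (Suc m) * f (Suc m) p q)"
| "gen_op GenAdag f = (\<lambda>m p q. if m = 0 then 0 else f (m - 1) p q)"
| "gen_op (GenAA Mi DMi) f = (\<lambda>m p q. of_nat (Suc p) * f m (Suc p) q)"
| "gen_op (GenAA Pl DPl) f = (\<lambda>m p q. if p = 0 then 0 else f m (p - 1) q)"
| "gen_op (GenAA Mi DPl) f = (\<lambda>m p q. of_nat (Suc q) * f m p (Suc q))"
| "gen_op (GenAA Pl DMi) f = (\<lambda>m p q. if q = 0 then 0 else f m p (q - 1))"

definition word_op :: "weyl_gen free_word \<Rightarrow> fock \<Rightarrow> fock" where
  "word_op w f = foldr gen_op (letters w) f"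

definition free_op :: "free_alg \<Rightarrow> fock \<Rightarrow> fock" where
  "free_op x f = (\<lambda>m p q. \<Sum>w\<in>Poly_Mapping.keys x. Poly_Mapping.lookup x w * word_op w f m p q)"

definition fock_comb :: "complex \<Rightarrow> fock \<Rightarrow> fock \<Rightarrow> fock" where
  "fock_comb c f g = (\<lambda>m p q. c * f m p q + g m p q)"

lemma gen_op_comb: "gen_op x (fock_comb c f g) = fock_comb c (gen_op x f) (gen_op x g)"
  by (cases "(x, f)" rule: gen_op.cases) (auto simp: fock_comb_def fun_eq_iff algebra_simps)

lemma word_op_comb: "word_op w (fock_comb c f g) = fock_comb c (word_op w f) (word_op w g)"
proof -
  have "foldr gen_op xs (fock_comb c f g) = fock_comb c (foldr gen_op xs f) (foldr gen_op xs g)" for xs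
    by (induction xs) (simp_all add: gen_op_comb)
  then show ?thesis by (simp add: word_op_def)
qed

lemma word_op_add: "word_op (u + v) f = word_op u (word_op v f)"
  by (simp add: word_op_def plus_free_word_def)

lemma free_op_superset:
  assumes "finite S" "Poly_Mapping.keys x \<subseteq> S"
  shows "free_op x f m p q = (\<Sum>w\<in>S. Poly_Mapping.lookup x w * word_op w f m p q)"
  unfolding free_op_def
  by (rule sum.mono_neutral_left) (use assms in \<open>auto simp: in_keys_iff\<close>)

lemma free_op_add: "free_op (x + y) f m p q = free_op x f m p q + free_op y f m p q"
proof -
  let ?S = "Poly_Mapping.keys x \<union> Poly_Mapping.keys y"
  have "Poly_Mapping.keys (x + y) \<subseteq> ?S" by (rule Poly_Mapping.keys_add)
  then show ?thesis
    by (simp add: free_op_superset[of ?S] lookup_add algebra_simps sum.distrib)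
qed

lemma free_op_single: "free_op (Poly_Mapping.single w c) f m p q = c * word_op w f m p q"
  by (subst free_op_superset[of "{w}"]) auto

lemma free_op_0 [simp]: "free_op 0 f = (\<lambda>m p q. 0)"
  by (simp add: free_op_def)

lemma free_op_uminus: "free_op (- x) f m p q = - free_op x f m p q"
  using free_op_add[of x "- x" f m p q] by (simp add: eq_neg_iff_add_eq_0 add.commute)

lemma free_op_diff: "free_op (x - y) f m p q = free_op x f m p q - free_op y f m p q"
  using free_op_add[of x "- y" f m p q] by (simp add: free_op_uminus)

lemma free_op_comb: "free_op x (fock_comb c f g) = fock_comb c (free_op x f) (free_op x g)"
  by (simp add: free_op_def word_op_comb fun_eq_iff)
     (simp add: fock_comb_def algebra_simps sum.distrib sum_distrib_left)

lemma free_op_mult: "free_op (x * y) f = free_op x (free_op y f)"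
proof (induction x rule: free_alg_induct)
  case zero
  show ?case by simp
next
  case (single_add w c x)
  have "free_op (Poly_Mapping.single w c * y) f m p q = c * word_op w (free_op y f) m p q" for m p q
  proof (induction y arbitrary: m p q rule: free_alg_induct)
    case zero
    have "word_op w (fock_comb (- 1) (\<lambda>m p q. 0) (\<lambda>m p q. 0)) = 
        fock_comb (- 1) (word_op w (\<lambda>m p q. 0)) (word_op w (\<lambda>m p q. 0))"
      by (rule word_op_comb)
    then show ?case by (simp add: fock_comb_def)
  next
    case (single_add v b y)
    have eq: "free_op (Poly_Mapping.single v b + y) f = fock_comb b (word_op v f) (free_op y f)"
      by (simp add: fun_eq_iff fock_comb_def free_op_add free_op_single)
    show ?case
      unfolding eq word_op_comb
      by (simp add: distrib_left free_op_add single_add mult_single free_op_single word_op_add)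
         (simp add: fock_comb_def algebra_simps)
  qed
  then show ?case
    using single_add by (simp add: fun_eq_iff distrib_right free_op_add free_op_single)
qed

lemma free_op_gen: "free_op (free_gen x) f = gen_op x f"
  by (simp add: fun_eq_iff free_gen_def free_op_single word_op_def)

lemma free_op_const: "free_op (Poly_Mapping.single 0 c) f m p q = c * f m p q"
  by (simp add: free_op_single word_op_def zero_free_word_def)

lemma free_op_1: "free_op 1 f = f"
  using free_op_const[of 1 f] by (simp add: fun_eq_iff)

lemma free_op_ideal: "x \<in> weyl_ideal \<Longrightarrow> free_op x f = (\<lambda>m p q. 0)"
proof (induction arbitrary: f rule: weyl_ideal.induct)
  case rel_a
  show ?case
    by (auto simp: fun_eq_iff commutator_def free_op_diff free_op_add free_op_mult free_op_gen free_op_1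
        algebra_simps)
next
  case (rel_aa \<alpha> \<alpha>' \<beta> \<beta>')
  show ?case
    by (cases \<alpha>; cases \<alpha>'; cases \<beta>; cases \<beta>')
       (auto simp: fun_eq_iff commutator_def free_op_diff free_op_add free_op_mult free_op_gen
         free_scale_def free_op_const free_op_1 algebra_simps)
next
  case (rel_a_aa \<alpha> \<alpha>')
  show ?case
    by (cases \<alpha>; cases \<alpha>')
       (auto simp: fun_eq_iff commutator_def free_op_diff free_op_add free_op_mult free_op_gen algebra_simps)
next
  case (rel_adag_aa \<alpha> \<alpha>')
  show ?case
    by (cases \<alpha>; cases \<alpha>')
       (auto simp: fun_eq_iff commutator_def free_op_diff free_op_add free_op_mult free_op_gen algebra_simps)
next
  case (mult_left x y)
  have "free_op y (fock_comb (- 1) (\<lambda>m p q. 0) (\<lambda>m p q. 0)) =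
      fock_comb (- 1) (free_op y (\<lambda>m p q. 0)) (free_op y (\<lambda>m p q. 0))"
    by (rule free_op_comb)
  with mult_left show ?case by (simp add: fock_comb_def free_op_mult)
qed (simp_all add: fun_eq_iff free_op_add free_op_mult)

lemma one_notin_weyl_ideal: "1 \<notin> weyl_ideal"
proof
  assume "1 \<in> weyl_ideal"
  from free_op_ideal[OF this, of "\<lambda>m p q. 1"] show False
    by (simp add: free_op_1 fun_eq_iff)
qed

instantiation weyl :: ring_1
begin

lift_definition zero_weyl :: weyl is 0 .
lift_definition one_weyl :: weyl is 1 .

lift_definition plus_weyl :: "weyl \<Rightarrow> weyl \<Rightarrow> weyl" is "(+)"
  by (metis add_diff_add weyl_ideal.add)

lift_definition uminus_weyl :: "weyl \<Rightarrow> weyl" is uminus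
  using weyl_ideal_uminus by fastforce

lift_definition minus_weyl :: "weyl \<Rightarrow> weyl \<Rightarrow> weyl" is "(-)"
proof -
  fix x x' y y' :: free_alg
  assume "x - x' \<in> weyl_ideal" "y - y' \<in> weyl_ideal"
  from weyl_ideal_diff[OF this] show "x - y - (x' - y') \<in> weyl_ideal"
    by (simp add: algebra_simps)
qed

lift_definition times_weyl :: "weyl \<Rightarrow> weyl \<Rightarrow> weyl" is "(*)"
proof -
  fix x x' y y' :: free_alg
  assume a: "x - x' \<in> weyl_ideal" "y - y' \<in> weyl_ideal"
  have "(x - x') * y + x' * (y - y') \<in> weyl_ideal"
    by (intro weyl_ideal.add weyl_ideal.mult_left weyl_ideal.mult_right a)
  then show "x * y - x' * y' \<in> weyl_ideal"
    by (simp add: algebra_simps)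
qed

instance
proof
  show "(0 :: weyl) \<noteq> 1"
    by transfer (metis diff_0 minus_minus one_notin_weyl_ideal weyl_ideal_uminus)
qed (transfer; simp add: algebra_simps weyl_ideal.zero)+

end

lift_definition weyl_scale :: "complex \<Rightarrow> weyl \<Rightarrow> weyl" is free_scale
  by (metis free_scale_def free_scale_simps(3) weyl_ideal.mult_left)

lift_definition weyl_dagger :: "weyl \<Rightarrow> weyl" is free_dagger
  using free_dagger_ideal by fastforce

lift_definition wa :: weyl is "free_gen GenA" .
lift_definition wadag :: weyl is "free_gen GenAdag" .
lift_definition waa :: "idx \<Rightarrow> didx \<Rightarrow> weyl" is "\<lambda>\<alpha> \<alpha>'. free_gen (GenAA \<alpha> \<alpha>')" .

lemma weyl_relations:
  "commutator wa wadag = 1"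
  "commutator (waa \<alpha> \<alpha>') (waa \<beta> \<beta>') = weyl_scale (- eps \<alpha> \<beta> * eta \<alpha>' \<beta>') 1"
  "commutator wa (waa \<alpha> \<alpha>') = 0"
  "commutator wadag (waa \<alpha> \<alpha>') = 0"
  unfolding commutator_def
  by (transfer, use weyl_ideal.intros(1-4)[unfolded commutator_def] in simp)+

lemma weyl_dagger_simps:
  "weyl_dagger (x + y) = weyl_dagger x + weyl_dagger y"
  "weyl_dagger (x * y) = weyl_dagger y * weyl_dagger x"
  "weyl_dagger (weyl_scale c x) = weyl_scale (cnj c) (weyl_dagger x)"
  "weyl_dagger wa = wadag" "weyl_dagger wadag = wa"
  "weyl_dagger (waa Pl DPl) = - waa Mi DMi" "weyl_dagger (waa Mi DMi) = - waa Pl DPl"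
  "weyl_dagger (waa Pl DMi) = waa Mi DPl" "weyl_dagger (waa Mi DPl) = waa Pl DMi"
  by (transfer, simp add: weyl_ideal.zero)+

definition wn :: weyl where
  "wn = 2 * wadag * wa"

definition wN :: weyl where
  "wN = waa Pl DMi * waa Mi DPl - waa Pl DPl * waa Mi DMi"

section \<open>Formal Laurent series over the Weyl algebra\<close>

text \<open>The central indeterminate \<^term>\<open>fls_X :: weyl fls\<close> plays the role of the square root of
  \<open>\<hbar>\<close>; hence \<open>\<hbar>\<^sup>k\<close> sits in degree \<open>2 * k\<close>.\<close>

type_synonym weyl_h = "weyl fls"

definition wh_scale :: "complex \<Rightarrow> weyl_h \<Rightarrow> weyl_h" where
  "wh_scale c f = fls_const (weyl_scale c 1) * f"

definition wh_dagger :: "weyl_h \<Rightarrow> weyl_h" where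
  "wh_dagger f = Abs_fls (\<lambda>k. weyl_dagger (fls_nth f k))"

lemma weyl_dagger_0 [simp]: "weyl_dagger 0 = 0"
  by (transfer, simp add: weyl_ideal.zero)

lemma wh_dagger_nth [simp]: "fls_nth (wh_dagger f) k = weyl_dagger (fls_nth f k)"
  unfolding wh_dagger_def
  by (rule nth_Abs_fls_lower_bound[of "fls_subdegree f"]) simp

definition wh_inverse_hbar :: weyl_h where
  "wh_inverse_hbar = fls_X_intpow (- 2)"

definition wh_sqrt :: weyl_h where
  "wh_sqrt = fls_X_intpow (- 1) * fps_to_fls (Abs_fps (\<lambda>d.
     if even d then
       let k = d div 2 in
       weyl_scale ((- 1) ^ k * (\<Prod>l<k. 1 - 2 * of_nat l) / (2 ^ k * fact k))
         ((wN + weyl_scale (1/2) wn) ^ k)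
     else 0))"

definition wh_a :: weyl_h where "wh_a = fls_const wa"
definition wh_adag :: weyl_h where "wh_adag = fls_const wadag"
definition wh_aa :: "idx \<Rightarrow> didx \<Rightarrow> weyl_h" where "wh_aa \<alpha> \<alpha>' = fls_const (waa \<alpha> \<alpha>')"

fun cal_K :: "didx \<Rightarrow> didx \<Rightarrow> weyl_h" where
  "cal_K DPl DPl = wh_scale (- 2 * \<i>) (wh_sqrt * wh_a)"
| "cal_K DPl DMi = wh_scale \<i> (wh_inverse_hbar - fls_const wN - fls_const wn)"
| "cal_K DMi DPl = wh_scale \<i> (wh_inverse_hbar - fls_const wN - fls_const wn)"
| "cal_K DMi DMi = wh_scale (2 * \<i>) (wh_adag * wh_sqrt)"

fun cal_P :: "idx \<Rightarrow> didx \<Rightarrow> weyl_h" where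
  "cal_P Pl DPl = - wh_aa Pl DMi * wh_a + wh_sqrt * wh_aa Pl DPl"
| "cal_P Mi DMi = wh_adag * wh_aa Mi DPl + wh_aa Mi DMi * wh_sqrt"
| "cal_P Pl DMi = wh_adag * wh_aa Pl DPl + wh_aa Pl DMi * wh_sqrt"
| "cal_P Mi DPl = - wh_aa Mi DMi * wh_a + wh_sqrt * wh_aa Mi DPl"

fun cal_J :: "idx \<Rightarrow> idx \<Rightarrow> weyl_h" where
  "cal_J Pl Pl = wh_scale (- 2 * \<i>) (wh_aa Pl DMi * wh_aa Pl DPl)"
| "cal_J Pl Mi = wh_scale (- \<i>) (wh_aa Pl DPl * wh_aa Mi DMi + wh_aa Mi DPl * wh_aa Pl DMi)"
| "cal_J Mi Pl = wh_scale (- \<i>) (wh_aa Pl DPl * wh_aa Mi DMi + wh_aa Mi DPl * wh_aa Pl DMi)"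
| "cal_J Mi Mi = wh_scale (- 2 * \<i>) (wh_aa Mi DPl * wh_aa Mi DMi)"

section \<open>Embeddings\<close>

definition sp4_embedding :: "(sp4 \<Rightarrow> weyl_h) \<Rightarrow> bool" where
  "sp4_embedding \<phi> \<longleftrightarrow>
     Vector_Spaces.linear scaleC wh_scale \<phi> \<and>
     (\<forall>X Y. \<phi> (sp4_bracket X Y) = commutator (\<phi> X) (\<phi> Y)) \<and> inj \<phi>"

text \<open>Here \<open>W\<^sup>\<hbar>\<close> is regarded as a real Lie algebra.\<close>

definition u2H_embedding :: "(u2H \<Rightarrow> weyl_h) \<Rightarrow> bool" where
  "u2H_embedding \<psi> \<longleftrightarrow>
     Vector_Spaces.linear scaleR (\<lambda>r. wh_scale (of_real r)) \<psi> \<and>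
     (\<forall>X Y. \<psi> (u2H_bracket X Y) = commutator (\<psi> X) (\<psi> Y)) \<and> inj \<psi>"

definition reality_preserving :: "(sp4 \<Rightarrow> weyl_h) \<Rightarrow> bool" where
  "reality_preserving \<phi> \<longleftrightarrow> (\<forall>X. \<phi> (sp4_dagger X) = wh_dagger (\<phi> X))"

text \<open>The complex linear map with the prescribed values on the basis of \<open>sp(4,C)\<close>.\<close>

definition given_on_basis :: "(sp4 \<Rightarrow> weyl_h) \<Rightarrow> bool" where
  "given_on_basis \<phi> \<longleftrightarrow>
     Vector_Spaces.linear scaleC wh_scale \<phi> \<and>
     (\<forall>\<alpha> \<beta>. \<phi> (sp4_J \<alpha> \<beta>) = cal_J \<alpha> \<beta>) \<and>
     (\<forall>\<alpha> \<alpha>'. \<phi> (sp4_P \<alpha> \<alpha>') = cal_P \<alpha> \<alpha>') \<and>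
     (\<forall>\<alpha>' \<beta>'. \<phi> (sp4_K \<alpha>' \<beta>') = cal_K \<alpha>' \<beta>')"

end

theory Submission
  imports Defs
begin

text \<open>
  All ten elements \<open>J\<close>, \<open>P\<close>, \<open>K\<close> are, up to factors \<open>\<plusminus>i\<close>, the components of one symmetric tensor
  \<open>M\<^sub>A\<^sub>B\<close>, where \<open>A\<close> and \<open>B\<close> run through the two undotted and the two dotted indices together. In
  this form the Lie algebra has the single bracket relation
  \<open>[M\<^sub>A\<^sub>B, M\<^sub>C\<^sub>D] = \<omega>\<^sub>A\<^sub>C M\<^sub>B\<^sub>D + \<omega>\<^sub>B\<^sub>C M\<^sub>A\<^sub>D + \<omega>\<^sub>A\<^sub>D M\<^sub>B\<^sub>C + \<omega>\<^sub>B\<^sub>D M\<^sub>A\<^sub>C\<close> of \<open>sp(4)\<close> with a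
  symplectic form \<open>\<omega>\<close> (\<open>sp4_gen_bracket\<close>, a computation with quaternionic matrices).

  Bilinears in four pairs of bosons \<open>y\<^sub>A\<close>, \<open>z\<^sub>A\<close> with \<open>[y\<^sub>A, z\<^sub>B] = \<omega>\<^sub>A\<^sub>B\<close> satisfy this relation: one takes
  \<open>M\<^sub>A\<^sub>B = z\<^sub>A y\<^sub>B + z\<^sub>B y\<^sub>A\<close>. The Weyl algebra at hand has only three pairs. As in the construction of
  Holstein and Primakoff, the fourth pair is eliminated by fixing the value of a charge that
  commutes with all \<open>M\<^sub>A\<^sub>B\<close>, and both its members are replaced by \<open>S = \<surd>(1/\<hbar> - T)\<close> with \<open>T = N + n/2\<close>. This \<open>S\<close>
  commutes with none of the other bosons, each of which shifts \<open>T\<close> by one unit; but moving a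
  boson past \<open>S\<close> merely replaces \<open>S\<close> by \<open>S' = \<surd>(1/\<hbar> - T - 1)\<close>, and \<open>S\<^sup>2 - S'\<^sup>2 = 1\<close> supplies the
  commutator of the missing pair. With primes for the replacement of \<open>S\<close> by \<open>S'\<close>, this gives the
  exchange relations \<open>y\<^sub>B z\<^sub>C = z'\<^sub>C y'\<^sub>B + \<omega>\<^sub>B\<^sub>C\<close>, \<open>z\<^sub>A z'\<^sub>C = z\<^sub>C z'\<^sub>A\<close> and
  \<open>y'\<^sub>B y\<^sub>D = y'\<^sub>D y\<^sub>B\<close> (\<open>ladder_exchange\<close>, \<open>ladder_up_sym\<close>, \<open>ladder_down_sym\<close>), and they
  imply the bracket relation in any ring, for skew and central \<open>\<omega>\<close> (\<open>sp_commutator\<close>). The elements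
  \<open>z\<^sub>A y\<^sub>B + z\<^sub>B y\<^sub>A\<close> are the prescribed images, rescaled by the same
  factors \<open>\<plusminus>i\<close> (\<open>wh_gen_table\<close>).

  The properties of \<open>S\<close> come from the observation that inserting \<open>\<hbar>T\<close> into complex power series is
  multiplicative (\<open>hbar_series_mult\<close>), applied to the binomial series for the exponent \<open>1/2\<close>.
  Reality holds because both involutions send \<open>M\<^sub>A\<^sub>B\<close> to the same multiple of the component with
  conjugate indices. Injectivity holds because the leading coefficients of the images are linearly
  independent: first the scalar in degree \<open>-2\<close>, then the generators of the Weyl algebra in degree
  \<open>-1\<close>, and finally quadratic elements in degree \<open>0\<close> (\<open>wh_gen_independent\<close>).
\<close>

section \<open>The symplectic form on the joined index set\<close>

type_synonym joint_index = "idx + didx"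

fun conj_index :: "joint_index \<Rightarrow> joint_index" where
  "conj_index (Inl Pl) = Inl Mi" | "conj_index (Inl Mi) = Inl Pl"
| "conj_index (Inr DPl) = Inr DMi" | "conj_index (Inr DMi) = Inr DPl"

fun index_sign :: "joint_index \<Rightarrow> complex" where
  "index_sign (Inl Pl) = -1" | "index_sign (Inl Mi) = 1"
| "index_sign (Inr DPl) = -1" | "index_sign (Inr DMi) = 1"

text \<open>On undotted indices this is \<open>-\<epsilon>\<close>. On dotted indices it is skew as well, hence different from the
  symmetric \<open>\<eta>\<close> that occurs in the relations of the Weyl algebra.\<close>

definition symp :: "joint_index \<Rightarrow> joint_index \<Rightarrow> complex" where
  "symp A B = (if B = conj_index A then index_sign A else 0)"

lemma symp_skew: "symp A B = - symp B A"
  by (cases A rule: conj_index.cases; cases B rule: conj_index.cases) (simp_all add: symp_def)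

section \<open>The complexified Lie algebra in symplectic form\<close>

text \<open>The factors \<open>i\<close> and \<open>-i\<close> give the brackets of all three families the same structure constants.\<close>

fun sp4_gen :: "joint_index \<Rightarrow> joint_index \<Rightarrow> sp4" where
  "sp4_gen (Inl \<alpha>) (Inl \<beta>) = scaleC \<i> (sp4_J \<alpha> \<beta>)"
| "sp4_gen (Inl \<alpha>) (Inr \<beta>) = sp4_P \<alpha> \<beta>"
| "sp4_gen (Inr \<alpha>) (Inl \<beta>) = sp4_P \<beta> \<alpha>"
| "sp4_gen (Inr \<alpha>) (Inr \<beta>) = scaleC (- \<i>) (sp4_K \<alpha> \<beta>)"

text \<open>The real and imaginary part of one matrix entry, that is, an element of the complexified
  quaternions, in which the bracket is an ordinary matrix commutator.\<close>

definition sp4_entry :: "sp4 \<Rightarrow> 2 \<Rightarrow> 2 \<Rightarrow> quat \<times> quat" where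
 "sp4_entry X r c = (Rep_u2H (cx_re X) $ r $ c, Rep_u2H (cx_im X) $ r $ c)"

lemma sp4_eqI: "sp4_entry X 1 1 = sp4_entry Y 1 1 \<Longrightarrow> sp4_entry X 1 2 = sp4_entry Y 1 2
  \<Longrightarrow> sp4_entry X 2 1 = sp4_entry Y 2 1 \<Longrightarrow> sp4_entry X 2 2 = sp4_entry Y 2 2 \<Longrightarrow> X = Y"
  by (cases X; cases Y) (simp add: sp4_entry_def Rep_u2H_inject[symmetric] vec_eq_iff forall_2)

lemma mat2_nth [simp]: "mat2 a b c d $ 1 $ 1 = a" "mat2 a b c d $ 1 $ 2 = b"
 "mat2 a b c d $ 2 $ 1 = c" "mat2 a b c d $ 2 $ 2 = d"
  by (simp_all add: mat2_def)

lemma quat_minus [simp]: "Quat a b c d - Quat a' b' c' d' = Quat (a - a') (b - b') (c - c') (d - d')"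
  by (simp add: minus_quat_def)

lemma entry_simps:
  "sp4_entry (X + Y) r c = sp4_entry X r c + sp4_entry Y r c"
  "sp4_entry (X - Y) r c = sp4_entry X r c - sp4_entry Y r c"
  "sp4_entry (- X) r c = - sp4_entry X r c"
  "sp4_entry (scaleC k X) r c = (Re k *\<^sub>R fst (sp4_entry X r c) - Im k *\<^sub>R snd (sp4_entry X r c),
     Re k *\<^sub>R snd (sp4_entry X r c) + Im k *\<^sub>R fst (sp4_entry X r c))"
  "sp4_entry (of_u2H V) r c = (Rep_u2H V $ r $ c, 0)"
  by (simp_all add: sp4_entry_def plus_complexified_def minus_complexified_def uminus_complexified_def
    scaleC_def of_u2H_def zero_u2H.rep_eq plus_u2H.rep_eq minus_u2H.rep_eq uminus_u2H.rep_eq scaleR_u2H.rep_eq)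

definition complex_quat_times :: "quat \<times> quat \<Rightarrow> quat \<times> quat \<Rightarrow> quat \<times> quat" where
  "complex_quat_times x y = (fst x * fst y - snd x * snd y, fst x * snd y + snd x * fst y)"

lemma entry_bracket:
  "sp4_entry (sp4_bracket X Y) r c = complex_quat_times (sp4_entry X r 1) (sp4_entry Y 1 c)
     + complex_quat_times (sp4_entry X r 2) (sp4_entry Y 2 c) - (complex_quat_times (sp4_entry Y r 1) (sp4_entry X 1 c)
     + complex_quat_times (sp4_entry Y r 2) (sp4_entry X 2 c))"
  by (simp add: sp4_bracket_def sp4_entry_def complex_quat_times_def u2H_bracket.rep_eq plus_u2H.rep_eq minus_u2H.rep_eq matrix_matrix_mult_def
    sum_2)

lemma entry_J: "sp4_entry (sp4_J a b) 1 1 = (case (a, b) of (Pl,Pl) \<Rightarrow> (Quat 0 (-1) 0 0, Quat 0 0 1 0)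
  | (Mi,Mi) \<Rightarrow> (Quat 0 1 0 0, Quat 0 0 1 0) | _ \<Rightarrow> (Quat 0 0 0 (-1), 0))"
  "sp4_entry (sp4_J a b) 1 2 = 0"   "sp4_entry (sp4_J a b) 2 1 = 0"   "sp4_entry (sp4_J a b) 2 2 = 0"
  by (cases a; cases b; simp add: entry_simps u2H_j.rep_eq zero_quat_def zero_prod_def)+

lemma entry_K: "sp4_entry (sp4_K a b) 2 2 = (case (a, b) of (DPl,DPl) \<Rightarrow> (Quat 0 1 0 0, Quat 0 0 1 0)
  | (DMi,DMi) \<Rightarrow> (Quat 0 (-1) 0 0, Quat 0 0 1 0) | _ \<Rightarrow> (Quat 0 0 0 (-1), 0))"
  "sp4_entry (sp4_K a b) 1 2 = 0"   "sp4_entry (sp4_K a b) 2 1 = 0"   "sp4_entry (sp4_K a b) 1 1 = 0"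
  by (cases a; cases b; simp add: entry_simps u2H_k.rep_eq zero_quat_def zero_prod_def)+

lemma entry_P: "sp4_entry (sp4_P a b) 1 1 = 0" "sp4_entry (sp4_P a b) 2 2 = 0"
  "sp4_entry (sp4_P a b) 1 2 = (case (a, b) of (Pl,DPl) \<Rightarrow> (Quat 0 0 0 (-1/2), Quat (-1/2) 0 0 0)
  | (Pl,DMi) \<Rightarrow> (Quat 0 (-1/2) 0 0, Quat 0 0 (1/2) 0)
  | (Mi,DPl) \<Rightarrow> (Quat 0 (1/2) 0 0, Quat 0 0 (1/2) 0) | (Mi,DMi) \<Rightarrow> (Quat 0 0 0 (-1/2), Quat (1/2) 0 0 0))"
  "sp4_entry (sp4_P a b) 2 1 = (case (a, b) of (Pl,DPl) \<Rightarrow> (Quat 0 0 0 (-1/2), Quat (1/2) 0 0 0)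
  | (Pl,DMi) \<Rightarrow> (Quat 0 (-1/2) 0 0, Quat 0 0 (1/2) 0)
  | (Mi,DPl) \<Rightarrow> (Quat 0 (1/2) 0 0, Quat 0 0 (1/2) 0) | (Mi,DMi) \<Rightarrow> (Quat 0 0 0 (-1/2), Quat (-1/2) 0 0 0))"
  by (cases a; cases b; simp add: entry_simps u2H_p0.rep_eq u2H_p.rep_eq zero_quat_def one_quat_def zero_prod_def)+

lemma sp4_gen_bracket:
  "sp4_bracket (sp4_gen A B) (sp4_gen C D) =
     scaleC (symp A C) (sp4_gen B D) + scaleC (symp B C) (sp4_gen A D)
   + scaleC (symp A D) (sp4_gen B C) + scaleC (symp B D) (sp4_gen A C)"
  by (cases A rule: conj_index.cases; cases B rule: conj_index.cases;
      cases C rule: conj_index.cases; cases D rule: conj_index.cases)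
    (rule sp4_eqI; simp del: sp4_J.simps sp4_P.simps sp4_K.simps add: symp_def entry_bracket
      entry_J entry_K entry_P entry_simps complex_quat_times_def zero_quat_def zero_prod_def)+

instance idx :: finite
proof
  have "(UNIV :: idx set) = {Pl, Mi}" using idx.exhaust by blast
  then show "finite (UNIV :: idx set)" by (metis finite.emptyI finite.insertI)
qed

instance didx :: finite
proof
  have "(UNIV :: didx set) = {DPl, DMi}" using didx.exhaust by blast
  then show "finite (UNIV :: didx set)" by (metis finite.emptyI finite.insertI)
qed

lemma UNIV_joint_index: "(UNIV :: joint_index set) = {Inl Pl, Inl Mi, Inr DPl, Inr DMi}"
proof -
  have "A \<in> {Inl Pl, Inl Mi, Inr DPl, Inr DMi}" for A :: joint_index
    by (cases A rule: conj_index.cases) simp_all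
  then show ?thesis by blast
qed

interpretation sp4: vector_space "scaleC :: complex \<Rightarrow> sp4 \<Rightarrow> sp4"
  by unfold_locales (simp_all add: scaleC_def plus_complexified_def algebra_simps)

definition sp4_comp :: "(quat \<Rightarrow> real) \<Rightarrow> 2 \<Rightarrow> 2 \<Rightarrow> sp4 \<Rightarrow> complex" where
  "sp4_comp q r c X = Complex (q (fst (sp4_entry X r c))) (q (snd (sp4_entry X r c)))"

text \<open>The coordinates refer to the expansion as a sum over all ordered pairs of indices. An element
  with two different indices occurs twice there, so its coordinate is half of the usual one.\<close>

fun coord_J :: "idx \<Rightarrow> idx \<Rightarrow> sp4 \<Rightarrow> complex" where
  "coord_J Pl Pl X = \<i> / 2 * (sp4_comp quat_i 1 1 X + \<i> * sp4_comp quat_j 1 1 X)"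
| "coord_J Mi Mi X = - \<i> / 2 * (sp4_comp quat_i 1 1 X - \<i> * sp4_comp quat_j 1 1 X)"
| "coord_J _ _ X = \<i> / 2 * sp4_comp quat_k 1 1 X"

fun coord_P :: "idx \<Rightarrow> didx \<Rightarrow> sp4 \<Rightarrow> complex" where
  "coord_P Pl DPl X = (- sp4_comp quat_k 1 2 X + \<i> * sp4_comp quat_re 1 2 X) / 2"
| "coord_P Mi DMi X = (- sp4_comp quat_k 1 2 X - \<i> * sp4_comp quat_re 1 2 X) / 2"
| "coord_P Pl DMi X = (- sp4_comp quat_i 1 2 X - \<i> * sp4_comp quat_j 1 2 X) / 2"
| "coord_P Mi DPl X = (sp4_comp quat_i 1 2 X - \<i> * sp4_comp quat_j 1 2 X) / 2"

fun coord_K :: "didx \<Rightarrow> didx \<Rightarrow> sp4 \<Rightarrow> complex" where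
  "coord_K DPl DPl X = \<i> / 2 * (sp4_comp quat_i 2 2 X - \<i> * sp4_comp quat_j 2 2 X)"
| "coord_K DMi DMi X = - \<i> / 2 * (sp4_comp quat_i 2 2 X + \<i> * sp4_comp quat_j 2 2 X)"
| "coord_K _ _ X = - \<i> / 2 * sp4_comp quat_k 2 2 X"

fun sp4_coord :: "joint_index \<Rightarrow> joint_index \<Rightarrow> sp4 \<Rightarrow> complex" where
  "sp4_coord (Inl \<alpha>) (Inl \<beta>) X = coord_J \<alpha> \<beta> X"
| "sp4_coord (Inl \<alpha>) (Inr \<beta>) X = coord_P \<alpha> \<beta> X"
| "sp4_coord (Inr \<alpha>) (Inl \<beta>) X = coord_P \<beta> \<alpha> X"
| "sp4_coord (Inr \<alpha>) (Inr \<beta>) X = coord_K \<alpha> \<beta> X"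

lemma sp4_coord_commute: "sp4_coord A B X = sp4_coord B A X"
  by (cases A rule: conj_index.cases; cases B rule: conj_index.cases) simp_all

lemma sp4_comp_linear:
  assumes "q \<in> {quat_re, quat_i, quat_j, quat_k}"
  shows "sp4_comp q r c (X + Y) = sp4_comp q r c X + sp4_comp q r c Y"
    "sp4_comp q r c (scaleC k X) = k * sp4_comp q r c X"
proof -
  have lin: "q (x + y) = q x + q y" "q (x - y) = q x - q y" "q (t *\<^sub>R x) = t * q x" for x y t
    using assms by (cases x; cases y; auto)+
  show "sp4_comp q r c (X + Y) = sp4_comp q r c X + sp4_comp q r c Y"
    by (simp add: sp4_comp_def entry_simps lin complex_eq_iff)
  show "sp4_comp q r c (scaleC k X) = k * sp4_comp q r c X"
    by (simp add: sp4_comp_def entry_simps lin complex_eq_iff)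
qed

lemma sp4_coord_linear:
  "sp4_coord A B (X + Y) = sp4_coord A B X + sp4_coord A B Y"
  "sp4_coord A B (scaleC k X) = k * sp4_coord A B X"
  by (cases A rule: conj_index.cases; cases B rule: conj_index.cases; simp add: sp4_comp_linear field_simps)+

text \<open>An antihermitean matrix has imaginary diagonal entries, and its upper right entry determines
  the lower left one; the coordinates above are read off from the former.\<close>

lemma u2H_entries:
  obtains a b c p q r s e f g where
    "Rep_u2H V $ 1 $ 1 = Quat 0 a b c" "Rep_u2H V $ 1 $ 2 = Quat p q r s"
    "Rep_u2H V $ 2 $ 1 = Quat (- p) q r s" "Rep_u2H V $ 2 $ 2 = Quat 0 e f g"
proof -
  have *: "quat_cnj (Rep_u2H V $ j $ i) = - (Rep_u2H V $ i $ j)" for i j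
    using Rep_u2H[of V] by (simp add: adjoint_mat_def vec_eq_iff)
  have diag: "\<exists>a b c. Rep_u2H V $ i $ i = Quat 0 a b c" for i
    using *[of i i] by (cases "Rep_u2H V $ i $ i") auto
  show thesis
    using *[of 1 2] diag[of 1] diag[of 2] that
    by (cases "Rep_u2H V $ 1 $ 2"; cases "Rep_u2H V $ 2 $ 1") auto
qed

lemma sp4_expand: "X = (\<Sum>A\<in>UNIV. \<Sum>B\<in>UNIV. scaleC (sp4_coord A B X) (sp4_gen A B))"
proof -
  obtain a b c p q r s e f g where re:
    "Rep_u2H (cx_re X) $ 1 $ 1 = Quat 0 a b c" "Rep_u2H (cx_re X) $ 1 $ 2 = Quat p q r s"
    "Rep_u2H (cx_re X) $ 2 $ 1 = Quat (- p) q r s" "Rep_u2H (cx_re X) $ 2 $ 2 = Quat 0 e f g"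
    by (rule u2H_entries)
  obtain a' b' c' p' q' r' s' e' f' g' where im:
    "Rep_u2H (cx_im X) $ 1 $ 1 = Quat 0 a' b' c'" "Rep_u2H (cx_im X) $ 1 $ 2 = Quat p' q' r' s'"
    "Rep_u2H (cx_im X) $ 2 $ 1 = Quat (- p') q' r' s'" "Rep_u2H (cx_im X) $ 2 $ 2 = Quat 0 e' f' g'"
    by (rule u2H_entries)
  have X: "sp4_entry X 1 1 = (Quat 0 a b c, Quat 0 a' b' c')" "sp4_entry X 1 2 = (Quat p q r s, Quat p' q' r' s')"
    "sp4_entry X 2 1 = (Quat (- p) q r s, Quat (- p') q' r' s')" "sp4_entry X 2 2 = (Quat 0 e f g, Quat 0 e' f' g')"
    by (simp_all add: sp4_entry_def re im)
  show ?thesis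
    by (rule sp4_eqI; simp add: UNIV_joint_index X entry_simps entry_J entry_K entry_P sp4_comp_def re im
         zero_quat_def zero_prod_def del: sp4_J.simps sp4_K.simps sp4_P.simps; simp add: field_simps)
qed

text \<open>The involution exchanges conjugate indices with the same sign rule for all three families; the
  images obey the same rule, see \<open>wh_dagger_gen\<close> below.\<close>

lemma sp4_dagger_gen: "sp4_dagger (sp4_gen A B) = scaleC (- index_sign A * index_sign B) (sp4_gen (conj_index A) (conj_index B))"
  by (cases A rule: conj_index.cases; cases B rule: conj_index.cases; simp add: sp4_dagger_def scaleC_def of_u2H_def
    plus_complexified_def minus_complexified_def uminus_complexified_def)

section \<open>Symplectic commutators from exchange relations\<close>

text \<open>For genuine bosons the elements \<open>z\<^sub>A y\<^sub>B\<close> span a copy of \<open>gl\<close>. The \<open>y\<close> need not commute among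
  themselves, nor the \<open>z\<close>; it is enough that they do so after one factor has been replaced by its primed
  version. Indeed, exchanging the two middle factors of \<open>z\<^sub>A y\<^sub>B z\<^sub>C y\<^sub>D\<close> yields,
  besides a term with \<open>g\<close>, the product \<open>(z\<^sub>A z'\<^sub>C) (y'\<^sub>B y\<^sub>D)\<close>, which is symmetric under interchange of the two pairs and cancels in the
  commutator.\<close>

lemma gl_commutator:
  fixes y z y' z' :: "'i \<Rightarrow> 'a::ring_1" and g :: "'i \<Rightarrow> 'i \<Rightarrow> 'a"
  assumes exchange: "\<And>B C. y B * z C = z' C * y' B + g B C"
    and z_sym: "\<And>A C. z A * z' C = z C * z' A"
    and y_sym: "\<And>B D. y' B * y D = y' D * y B"
    and central: "\<And>A B x. g A B * x = x * g A B"
  shows "commutator (z A * y B) (z C * y D) = g B C * (z A * y D) - g D A * (z C * y B)"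
proof -
  have prod: "(z A * y B) * (z C * y D) = (z A * z' C) * (y' B * y D) + g B C * (z A * y D)" for A B C D
  proof -
    have "(z A * y B) * (z C * y D) = z A * (y B * z C) * y D"
      by (simp add: mult.assoc)
    also have "\<dots> = z A * z' C * (y' B * y D) + z A * g B C * y D"
      by (simp add: exchange distrib_left distrib_right mult.assoc)
    also have "z A * g B C * y D = g B C * (z A * y D)"
      by (simp add: mult.assoc flip: central[of B C "z A"])
    finally show ?thesis .
  qed
  show ?thesis
    unfolding commutator_def prod by (simp add: z_sym[of C A] y_sym[of D B])
qed

text \<open>Skewness of the form turns the eight terms from \<open>gl\<close> into the four terms of \<open>sp\<close>.\<close>

lemma sp_commutator:
  fixes y z y' z' :: "'i \<Rightarrow> 'a::ring_1" and g :: "'i \<Rightarrow> 'i \<Rightarrow> 'a"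
  assumes exchange: "\<And>B C. y B * z C = z' C * y' B + g B C"
    and z_sym: "\<And>A C. z A * z' C = z C * z' A"
    and y_sym: "\<And>B D. y' B * y D = y' D * y B"
    and central: "\<And>A B x. g A B * x = x * g A B"
    and skew: "\<And>A B. g A B = - g B A"
  defines "M \<equiv> \<lambda>A B. z A * y B + z B * y A"
  shows "commutator (M A B) (M C D) = g A C * M B D + g B C * M A D + g A D * M B C + g B D * M A C"
proof -
  have bilin: "commutator (p + q) (r + s) = commutator p r + commutator p s + commutator q r + commutator q s"
    for p q r s :: 'a by (simp add: commutator_def algebra_simps)
  show ?thesis
    unfolding M_def bilin gl_commutator[of y z z' y' g, OF exchange z_sym y_sym central]
    by (simp add: skew[of D A] skew[of C A] skew[of D B] skew[of C B] algebra_simps)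
qed

section \<open>Scalars and the square root in the Laurent series algebra\<close>

lemma weyl_scale_eq_mult: "weyl_scale c x = weyl_scale c 1 * x"
  by transfer (simp add: free_scale_def weyl_ideal.zero)

lemma weyl_scale_1_central: "weyl_scale c 1 * x = x * weyl_scale c 1"
  by transfer (simp add: free_scale_def single_0_central weyl_ideal.zero)

lemma weyl_scale_mult: "weyl_scale c x * y = weyl_scale c (x * y)" "x * weyl_scale c y = weyl_scale c (x * y)"
  by (metis weyl_scale_eq_mult weyl_scale_1_central mult.assoc)+

lemma weyl_scale_add_left: "weyl_scale (c + d) x = weyl_scale c x + weyl_scale d x"
  by transfer (simp add: free_scale_def single_add distrib_right weyl_ideal.zero)

lemma weyl_scale_add_right: "weyl_scale c (x + y) = weyl_scale c x + weyl_scale c y"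
  by transfer (simp add: weyl_ideal.zero)

lemma weyl_scale_scale: "weyl_scale c (weyl_scale d x) = weyl_scale (c * d) x"
  by transfer (simp add: free_scale_def mult_single weyl_ideal.zero flip: mult.assoc)

lemma weyl_scale_1: "weyl_scale 1 x = x"
  by transfer (simp add: weyl_ideal.zero)

lemma vector_space_weyl_scale: "vector_space weyl_scale"
  by unfold_locales (simp_all add: weyl_scale_add_left weyl_scale_add_right weyl_scale_scale weyl_scale_1)

interpretation weyl: vector_space weyl_scale
  by (rule vector_space_weyl_scale)

lemma wh_scale_nth [simp]: "fls_nth (wh_scale c f) k = weyl_scale c (fls_nth f k)"
  by (simp add: wh_scale_def weyl_scale_eq_mult[of c "fls_nth f k"])

interpretation wh: vector_space wh_scale
  by unfold_locales (auto intro!: fls_eqI simp: weyl.scale_left_distrib weyl.scale_right_distrib)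

lemma wh_scale_mult: "wh_scale c f * g = wh_scale c (f * g)" "f * wh_scale c g = wh_scale c (f * g)"
proof -
  have central: "fls_const (weyl_scale c 1) * f = f * fls_const (weyl_scale c 1)" for f :: weyl_h
    by (intro fls_eqI) (simp add: weyl_scale_1_central)
  show "wh_scale c f * g = wh_scale c (f * g)" by (simp add: wh_scale_def mult.assoc)
  show "f * wh_scale c g = wh_scale c (f * g)"
    by (simp add: wh_scale_def flip: mult.assoc central)
qed

text \<open>The substitution of \<open>\<hbar>T\<close> into a complex power series \<open>f\<close>. As \<open>\<surd>\<hbar>\<close> is the indeterminate, the
  \<open>k\<close>-th coefficient sits in degree \<open>2k\<close>.\<close>

definition hbar_series :: "weyl \<Rightarrow> complex fps \<Rightarrow> weyl fps" where
  "hbar_series T f = Abs_fps (\<lambda>d. if even d then weyl_scale (fps_nth f (d div 2)) (T ^ (d div 2)) else 0)"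

lemma hbar_series_mult: "hbar_series T f * hbar_series T g = hbar_series T (f * g)"
proof (rule fps_ext)
  fix d
  let ?F = "\<lambda>i. fps_nth (hbar_series T f) i * fps_nth (hbar_series T g) (d - i)"
  have "fps_nth (hbar_series T f * hbar_series T g) d = sum ?F {0..d}"
    by (simp add: fps_mult_nth)
  also have "\<dots> = sum ?F {i. i \<le> d \<and> even i}"
    by (rule sum.mono_neutral_right) (auto simp: hbar_series_def)
  also have "\<dots> = fps_nth (hbar_series T (f * g)) d"
  proof (cases "even d")
    case False
    then have "?F i = 0" if "i \<le> d" "even i" for i
      using that by (simp add: hbar_series_def)
    then show ?thesis using False by (simp add: hbar_series_def)
  next
    case True
    then obtain k where d: "d = 2 * k" by blast
    have "{i. i \<le> d \<and> even i} = (\<lambda>j. 2 * j) ` {0..k}"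
      by (auto simp: d dvd_def)
    then have "sum ?F {i. i \<le> d \<and> even i} = (\<Sum>j=0..k. ?F (2 * j))"
      by (simp add: sum.reindex inj_on_def o_def)
    also have "\<dots> = (\<Sum>j=0..k. weyl_scale (fps_nth f j * fps_nth g (k - j)) (T ^ k))"
    proof (rule sum.cong[OF refl])
      fix j assume "j \<in> {0..k}"
      then have "T ^ k = T ^ j * T ^ (k - j)" "(2 * k - 2 * j) div 2 = k - j"
        by (simp_all flip: power_add)
      then show "?F (2 * j) = weyl_scale (fps_nth f j * fps_nth g (k - j)) (T ^ k)"
        by (simp add: hbar_series_def d weyl_scale_mult)
    qed
    also have "\<dots> = fps_nth (hbar_series T (f * g)) d"
      by (simp add: hbar_series_def d fps_mult_nth weyl.scale_sum_left)
    finally show ?thesis .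
  qed
  finally show "fps_nth (hbar_series T f * hbar_series T g) d = fps_nth (hbar_series T (f * g)) d" .
qed

text \<open>The square root of \<open>1/\<hbar> + T\<close>, expanded as \<open>\<surd>(1 + \<hbar>T) / \<surd>\<hbar>\<close>.\<close>

definition hbar_sqrt :: "weyl \<Rightarrow> weyl_h" where
  "hbar_sqrt T = fls_X_intpow (- 1) * fps_to_fls (hbar_series T (fps_binomial (1/2)))"

lemma shift_one_mult: "fls_shift n 1 * f = fls_shift n f" for f :: weyl_h
  using fls_X_intpow_times_conv_shift(1)[of "- n" f] by simp

lemma X_intpow_central: "fls_X_intpow i * f = f * fls_X_intpow i" for f :: weyl_h
  by (rule fls_X_intpow_times_comm)

text \<open>The binomial series for the exponent \<open>1/2\<close> squares to \<open>1 + x\<close>, and substitution is multiplicative.\<close>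

lemma hbar_sqrt_square: "hbar_sqrt T * hbar_sqrt T = wh_inverse_hbar + fls_const T"
proof -
  let ?E = "fps_to_fls (hbar_series T (fps_binomial (1/2)))"
  have "hbar_sqrt T * hbar_sqrt T = fls_X_intpow (- 1) * (?E * fls_X_intpow (- 1)) * ?E"
    unfolding hbar_sqrt_def by (simp only: mult.assoc)
  also have "\<dots> = (fls_X_intpow (- 1) * fls_X_intpow (- 1)) * (?E * ?E)"
    by (simp only: mult.assoc X_intpow_central[of "-1" ?E, symmetric])
  also have "\<dots> = fls_X_intpow (- 2) * fps_to_fls (hbar_series T (1 + fps_X))"
    unfolding fls_X_intpow_times_fls_X_intpow
    by (simp add: fls_times_fps_to_fls[symmetric] hbar_series_mult fps_binomial_add_mult[symmetric] fps_binomial_1)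
  also have "\<dots> = wh_inverse_hbar + fls_const T"
  proof -
    have "hbar_series T (1 + fps_X) = 1 + fps_const T * fps_X ^ 2"
    proof (rule fps_ext)
      fix d :: nat
      consider "d = 0" | "d = 2" | "d \<noteq> 0" "d \<noteq> 2" by blast
      then show "fps_nth (hbar_series T (1 + fps_X)) d = fps_nth (1 + fps_const T * fps_X ^ 2) d"
      proof cases
        case 3
        then have "d div 2 \<noteq> 0" "d div 2 \<noteq> 1" if "even d" using that by presburger+
        with 3 show ?thesis by (auto simp: hbar_series_def fps_X_nth)
      qed (simp_all add: hbar_series_def fps_X_nth weyl_scale_1)
    qed
    then show ?thesis
      by (intro fls_eqI) (auto simp: wh_inverse_hbar_def shift_one_mult fps_X_power_nth nat_eq_iff)
  qed
  finally show ?thesis .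
qed

text \<open>An intertwiner of \<open>T\<close> and \<open>T'\<close> intertwines all their powers, hence every coefficient.\<close>

lemma hbar_sqrt_intertwine:
  assumes "w * T = T' * w"
  shows "fls_const w * hbar_sqrt T = hbar_sqrt T' * fls_const w"
proof -
  have "w * T ^ k = T' ^ k * w" for k
  proof (induction k)
    case (Suc k)
    have "w * T ^ Suc k = T' * (w * T ^ k)"
      by (simp add: assms flip: mult.assoc)
    then show ?case by (simp add: Suc mult.assoc)
  qed simp
  then show ?thesis
    unfolding hbar_sqrt_def
    by (intro fls_eqI) (simp add: shift_one_mult hbar_series_def weyl_scale_mult)
qed

text \<open>The coefficients in the definition of the root are those of the binomial series, with the sign
  \<open>(-1)\<^sup>k\<close> absorbed into the argument.\<close>

lemma wh_sqrt_eq: "wh_sqrt = hbar_sqrt (- (wN + weyl_scale (1/2) wn))"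
proof -
  have "(1/2 :: complex) gchoose k = (\<Prod>l<k. 1 - 2 * of_nat l) / (2 ^ k * fact k)" for k
  proof -
    have "(\<Prod>l<k. 1/2 - of_nat l :: complex) = (\<Prod>l<k. (1 - 2 * of_nat l) / 2)"
      by (rule prod.cong) (simp_all add: field_simps)
    then show ?thesis
      by (simp add: gbinomial_prod_rev prod_dividef lessThan_atLeast0)
  qed
  then have "weyl_scale ((1/2) gchoose k) ((- w) ^ k) =
      weyl_scale ((- 1) ^ k * (\<Prod>l<k. 1 - 2 * of_nat l) / (2 ^ k * fact k)) (w ^ k)" for w k
    by (cases "even k") (simp_all add: power_minus_odd)
  then show ?thesis
    by (simp add: wh_sqrt_def hbar_sqrt_def hbar_series_def Let_def cong: if_cong del: minus_add_distrib)
qed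

section \<open>Ladder elements and their exchange relations\<close>

lemma weyl_swap:
  "wa * wadag = wadag * wa + 1"
  "waa \<alpha> \<alpha>' * waa \<beta> \<beta>' = waa \<beta> \<beta>' * waa \<alpha> \<alpha>' - weyl_scale (eps \<alpha> \<beta> * eta \<alpha>' \<beta>') 1"
  "waa \<alpha> \<alpha>' * wa = wa * waa \<alpha> \<alpha>'"
  "waa \<alpha> \<alpha>' * wadag = wadag * waa \<alpha> \<alpha>'"
  using weyl_relations unfolding commutator_def by (simp_all add: algebra_simps)

abbreviation total_weight :: weyl where "total_weight \<equiv> wN + weyl_scale (1/2) wn"

lemma half_wn: "weyl_scale (1/2) wn = wadag * wa"
proof -
  have wn: "wn = weyl_scale 2 (wadag * wa)"
    using weyl_scale_add_left[of 1 1 "wadag * wa"]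
    by (simp add: wn_def weyl_scale_1 mult_2 distrib_right)
  show ?thesis
    unfolding wn weyl_scale_scale by (simp add: weyl_scale_1)
qed

text \<open>Normal order: \<open>a\<^sup>\<dagger>\<close> and \<open>a\<close> come first, in this order, and among the \<open>a\<^sup>\<alpha>\<close> the raising ones precede the
  lowering ones; the last two rules fix an order within each of the two kinds.\<close>

lemmas normal_order =
  weyl_swap(1) weyl_swap(3,4)
  weyl_swap(2)[of Pl DPl Pl DMi] weyl_swap(2)[of Pl DPl Mi DMi]
  weyl_swap(2)[of Mi DPl Pl DMi] weyl_swap(2)[of Mi DPl Mi DMi]
  weyl_swap(2)[of Pl DPl Mi DPl] weyl_swap(2)[of Pl DMi Mi DMi]

lemma mult_swap_assoc: "a * b = c \<Longrightarrow> a * (b * d) = c * d" for a b c d :: "'a::semigroup_mult"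
  by (simp flip: mult.assoc)

lemmas normal_order_assoc = normal_order[THEN mult_swap_assoc]

text \<open>The elements \<open>a\<close> and \<open>a\<^sup>\<alpha>\<close> with dotted index \<open>DPl\<close> lower \<open>T = N + n/2\<close> by one. For \<open>\<alpha> = +\<close> this is
  a creation operator, but its mode enters \<open>N\<close> with a minus sign.\<close>

lemma lowering_weight:
  "wa * total_weight = (total_weight + 1) * wa" "waa \<alpha> DPl * total_weight = (total_weight + 1) * waa \<alpha> DPl"
  unfolding half_wn wN_def
  by (simp_all add: algebra_simps normal_order normal_order_assoc weyl_scale_1 weyl_scale_mult)
    (cases \<alpha>; simp add: algebra_simps normal_order normal_order_assoc weyl_scale_1 weyl_scale_mult)

lemma raising_weight: "total_weight * wadag = wadag * (total_weight + 1)" "total_weight * waa \<alpha> DMi = waa \<alpha> DMi * (total_weight + 1)"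
  unfolding half_wn wN_def
  by (simp_all add: algebra_simps normal_order normal_order_assoc weyl_scale_1 weyl_scale_mult)
    (cases \<alpha>; simp add: algebra_simps normal_order normal_order_assoc weyl_scale_1 weyl_scale_mult)

text \<open>The root \<open>S'\<close> that \<open>S\<close> turns into when it is moved past a boson.\<close>

definition wh_sqrt_shifted :: weyl_h where "wh_sqrt_shifted = hbar_sqrt (- (total_weight + 1))"

lemma wh_sqrt_swap:
  "wh_a * wh_sqrt = wh_sqrt_shifted * wh_a" "wh_aa \<alpha> DPl * wh_sqrt = wh_sqrt_shifted * wh_aa \<alpha> DPl"
  "wh_sqrt * wh_adag = wh_adag * wh_sqrt_shifted" "wh_sqrt * wh_aa \<alpha> DMi = wh_aa \<alpha> DMi * wh_sqrt_shifted"
proof -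
  have neg: "w * T = T' * w \<Longrightarrow> w * - T = - T' * w" for w T T' :: weyl by simp
  have neg': "T * w = w * T' \<Longrightarrow> w * - T' = - T * w" for w T T' :: weyl by simp
  show "wh_a * wh_sqrt = wh_sqrt_shifted * wh_a" "wh_aa \<alpha> DPl * wh_sqrt = wh_sqrt_shifted * wh_aa \<alpha> DPl"
    unfolding wh_a_def wh_aa_def wh_sqrt_eq wh_sqrt_shifted_def
    by (intro hbar_sqrt_intertwine neg lowering_weight)+
  show "wh_sqrt * wh_adag = wh_adag * wh_sqrt_shifted" "wh_sqrt * wh_aa \<alpha> DMi = wh_aa \<alpha> DMi * wh_sqrt_shifted"
    unfolding wh_adag_def wh_aa_def wh_sqrt_eq wh_sqrt_shifted_def
    by (intro hbar_sqrt_intertwine[symmetric] neg' raising_weight)+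
qed

lemma wh_sqrt_square: "wh_sqrt * wh_sqrt = wh_inverse_hbar - fls_const wN - wh_adag * wh_a"
  unfolding wh_sqrt_eq hbar_sqrt_square half_wn wh_adag_def wh_a_def
  by (simp add: algebra_simps flip: fls_plus_const fls_minus_const)

lemma wh_sqrt_shifted_square: "wh_sqrt * wh_sqrt = wh_sqrt_shifted * wh_sqrt_shifted + 1"
  unfolding wh_sqrt_eq wh_sqrt_shifted_def hbar_sqrt_square
  by (simp add: fls_plus_const[symmetric] algebra_simps del: minus_add_distrib)

text \<open>The four boson pairs. The argument \<open>S\<close> takes the place of both members of the eliminated pair,
  which are the lowering element with index \<open>DMi\<close> and the raising element with index \<open>DPl\<close>; it is
  a parameter in order to accommodate the shifted root. The sign at \<open>a\<close> makes the exchange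
  relations match the form \<open>symp\<close>.\<close>

fun ladder_down :: "weyl_h \<Rightarrow> joint_index \<Rightarrow> weyl_h" where
  "ladder_down S (Inl \<alpha>) = wh_aa \<alpha> DPl" | "ladder_down S (Inr DPl) = - wh_a" | "ladder_down S (Inr DMi) = S"

fun ladder_up :: "weyl_h \<Rightarrow> joint_index \<Rightarrow> weyl_h" where
  "ladder_up S (Inl \<alpha>) = wh_aa \<alpha> DMi" | "ladder_up S (Inr DPl) = S" | "ladder_up S (Inr DMi) = wh_adag"

lemma wh_swap:
  "wh_a * wh_adag = wh_adag * wh_a + 1"
  "wh_aa \<alpha> \<alpha>' * wh_aa \<beta> \<beta>' = wh_aa \<beta> \<beta>' * wh_aa \<alpha> \<alpha>' - wh_scale (eps \<alpha> \<beta> * eta \<alpha>' \<beta>') 1"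
  "wh_aa \<alpha> \<alpha>' * wh_a = wh_a * wh_aa \<alpha> \<alpha>'"
  "wh_aa \<alpha> \<alpha>' * wh_adag = wh_adag * wh_aa \<alpha> \<alpha>'"
  unfolding wh_a_def wh_adag_def wh_aa_def wh_scale_def fls_const_mult_const weyl_swap(1,3,4) weyl_swap(2)[of \<alpha> \<alpha>' \<beta> \<beta>']
  by (simp_all flip: fls_plus_const fls_minus_const)

lemma wh_aa_commute: "wh_aa \<alpha> \<gamma> * wh_aa \<beta> \<gamma> = wh_aa \<beta> \<gamma> * wh_aa \<alpha> \<gamma>"
  using wh_swap(2)[of \<alpha> \<gamma> \<beta> \<gamma>] by (cases \<gamma>) simp_all

text \<open>For the eliminated pair this is \<open>S\<^sup>2 = S'\<^sup>2 + 1\<close>. For a mixed pair it is the rule for moving a boson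
  past \<open>S\<close>, and otherwise a relation of the Weyl algebra, in which \<open>S\<close> does not occur.\<close>

lemma ladder_exchange:
  "ladder_down wh_sqrt B * ladder_up wh_sqrt C = ladder_up wh_sqrt_shifted C * ladder_down wh_sqrt_shifted B + wh_scale (symp B C) 1"
proof -
  have eq: "eps \<alpha> \<beta> = - symp (Inl \<alpha>) (Inl \<beta>)" for \<alpha> \<beta>
    by (cases \<alpha>; cases \<beta>) (simp_all add: symp_def)
  show ?thesis
  proof (cases B; cases C)
    fix \<alpha> \<beta> assume "B = Inl \<alpha>" "C = Inl \<beta>"
    then show ?thesis by (simp add: wh_swap(2)[of \<alpha> DPl \<beta> DMi] eq wh.scale_minus_left)
  next
    fix \<alpha> \<beta> assume "B = Inl \<alpha>" "C = Inr \<beta>"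
    then show ?thesis by (cases \<beta>; cases \<alpha>) (simp_all add: symp_def wh_swap wh_sqrt_swap)
  next
    fix \<alpha> \<beta> assume "B = Inr \<alpha>" "C = Inl \<beta>"
    then show ?thesis by (cases \<alpha>; cases \<beta>) (simp_all add: symp_def wh_swap wh_sqrt_swap)
  next
    fix \<alpha> \<beta> assume "B = Inr \<alpha>" "C = Inr \<beta>"
    then show ?thesis
      by (cases \<alpha>; cases \<beta>) (simp_all add: symp_def wh_swap wh_sqrt_swap wh_sqrt_shifted_square wh.scale_minus_left)
  qed
qed

lemma ladder_up_sym: "ladder_up wh_sqrt A * ladder_up wh_sqrt_shifted C = ladder_up wh_sqrt C * ladder_up wh_sqrt_shifted A"
  by (cases "(wh_sqrt, A)" rule: ladder_up.cases; cases "(wh_sqrt, C)" rule: ladder_up.cases)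
    (auto simp: wh_sqrt_swap wh_aa_commute wh_swap(3,4))

lemma ladder_down_sym: "ladder_down wh_sqrt_shifted B * ladder_down wh_sqrt D = ladder_down wh_sqrt_shifted D * ladder_down wh_sqrt B"
  by (cases "(wh_sqrt, B)" rule: ladder_down.cases; cases "(wh_sqrt, D)" rule: ladder_down.cases)
    (auto simp: wh_sqrt_swap wh_aa_commute wh_swap(3,4))

definition wh_gen :: "joint_index \<Rightarrow> joint_index \<Rightarrow> weyl_h" where
  "wh_gen A B = ladder_up wh_sqrt A * ladder_down wh_sqrt B + ladder_up wh_sqrt B * ladder_down wh_sqrt A"

lemma wh_gen_commutator:
  "commutator (wh_gen A B) (wh_gen C D) = wh_scale (symp A C) (wh_gen B D) + wh_scale (symp B C) (wh_gen A D)
   + wh_scale (symp A D) (wh_gen B C) + wh_scale (symp B D) (wh_gen A C)"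
proof -
  have scalar: "wh_scale c 1 * f = wh_scale c f" "f * wh_scale c 1 = wh_scale c f" for c f
    by (simp_all add: wh_scale_mult)
  have skew: "wh_scale (symp A B) 1 = - wh_scale (symp B A) 1" for A B
    by (metis symp_skew wh.scale_minus_left)
  show ?thesis
    using sp_commutator[of "ladder_down wh_sqrt" "ladder_up wh_sqrt" "ladder_up wh_sqrt_shifted"
      "ladder_down wh_sqrt_shifted" "\<lambda>A B. wh_scale (symp A B) 1" A B C D,
      OF ladder_exchange ladder_up_sym ladder_down_sym _ skew]
    unfolding wh_gen_def[symmetric] scalar by blast
qed

text \<open>The order of factors in the prescribed images differs from the one here only in the \<open>J\<close> part, where
  the scalars produced by reordering cancel. In the mixed \<open>K\<close> component, \<open>S\<^sup>2 - a\<^sup>\<dagger>a\<close> becomes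
  \<open>1/\<hbar> - N - n\<close>.\<close>

lemma wh_gen_table:
  "wh_gen (Inl \<alpha>) (Inl \<beta>) = wh_scale \<i> (cal_J \<alpha> \<beta>)"
  "wh_gen (Inl \<alpha>) (Inr \<beta>') = cal_P \<alpha> \<beta>'" "wh_gen (Inr \<alpha>') (Inl \<beta>) = cal_P \<beta> \<alpha>'"
  "wh_gen (Inr \<alpha>') (Inr \<beta>') = wh_scale (- \<i>) (cal_K \<alpha>' \<beta>')"
proof -
  have two: "wh_scale 2 x = x + x" for x
    using wh.scale_left_distrib[of 1 1 x] by simp
  show "wh_gen (Inl \<alpha>) (Inl \<beta>) = wh_scale \<i> (cal_J \<alpha> \<beta>)"
    by (cases \<alpha>; cases \<beta>) (simp_all add: wh_gen_def two wh.scale_right_distrib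
      wh_aa_commute[of Mi DPl Pl] wh_swap(2)[of Mi DPl Mi DMi] wh_swap(2)[of Mi DPl Pl DMi] wh_swap(2)[of Pl DPl Mi DMi] algebra_simps)
  show P: "wh_gen (Inl \<alpha>) (Inr \<beta>') = cal_P \<alpha> \<beta>'" for \<alpha> \<beta>'
    by (cases \<alpha>; cases \<beta>') (simp_all add: wh_gen_def)
  show "wh_gen (Inr \<alpha>') (Inl \<beta>) = cal_P \<beta> \<alpha>'"
    unfolding P[symmetric] by (simp add: wh_gen_def add.commute)
  have ii: "\<i> * (2 * \<i>) = - 2" by simp
  have wn: "fls_const wn = wh_adag * wh_a + wh_adag * wh_a"
    by (simp add: wn_def wh_adag_def wh_a_def mult_2 distrib_right fls_plus_const[symmetric])
  show "wh_gen (Inr \<alpha>') (Inr \<beta>') = wh_scale (- \<i>) (cal_K \<alpha>' \<beta>')"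
    by (cases \<alpha>'; cases \<beta>') (simp_all add: wh_gen_def two ii wn wh_sqrt_square)
qed

section \<open>The involution\<close>

lemma weyl_dagger_1: "weyl_dagger 1 = 1"
  by transfer (simp add: weyl_ideal.zero)

lemma weyl_dagger_uminus: "weyl_dagger (- x) = - weyl_dagger x"
  by transfer (simp add: weyl_ideal.zero)

lemma weyl_dagger_diff: "weyl_dagger (x - y) = weyl_dagger x - weyl_dagger y"
  by transfer (simp add: weyl_ideal.zero)

lemma weyl_dagger_sum: "weyl_dagger (sum f A) = (\<Sum>i\<in>A. weyl_dagger (f i))"
  by (induction A rule: infinite_finite_induct) (simp_all add: weyl_dagger_simps)

lemma wh_dagger_add: "wh_dagger (f + g) = wh_dagger f + wh_dagger g"
  by (intro fls_eqI) (simp add: weyl_dagger_simps)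

lemma wh_dagger_uminus: "wh_dagger (- f) = - wh_dagger f"
  by (intro fls_eqI) (simp add: weyl_dagger_uminus)

lemma wh_dagger_scale: "wh_dagger (wh_scale c f) = wh_scale (cnj c) (wh_dagger f)"
  by (intro fls_eqI) (simp add: weyl_dagger_simps)

lemma wh_dagger_const: "wh_dagger (fls_const w) = fls_const (weyl_dagger w)"
  by (intro fls_eqI) simp

lemma wh_dagger_shift_fps:
  "wh_dagger (fls_shift m (fps_to_fls F)) = fls_shift m (fps_to_fls (Abs_fps (\<lambda>d. weyl_dagger (fps_nth F d))))"
  by (intro fls_eqI) simp

text \<open>Up to powers of the indeterminate both factors are power series, for which the claim is the
  reversal of the summation in the Cauchy product.\<close>

lemma wh_dagger_mult: "wh_dagger (f * g) = wh_dagger g * wh_dagger f"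
proof -
  obtain m F where f: "f = fls_shift m (fps_to_fls F)"
    by (metis fls_conv_base_factor_to_fps_shift_subdegree)
  obtain n G where g: "g = fls_shift n (fps_to_fls G)"
    by (metis fls_conv_base_factor_to_fps_shift_subdegree)
  have "weyl_dagger (fps_nth (F * G) d) = (\<Sum>i=0..d. weyl_dagger (fps_nth G i) * weyl_dagger (fps_nth F (d - i)))" for d
    unfolding fps_mult_nth weyl_dagger_sum
    by (subst sum.atLeastAtMost_rev) (auto intro!: sum.cong simp: weyl_dagger_simps)
  then have "Abs_fps (\<lambda>d. weyl_dagger (fps_nth (F * G) d)) =
      Abs_fps (\<lambda>d. weyl_dagger (fps_nth G d)) * Abs_fps (\<lambda>d. weyl_dagger (fps_nth F d))"
    by (intro fps_ext) (simp add: fps_mult_nth)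
  then show ?thesis
    unfolding f g fls_times_both_shifted_simp wh_dagger_shift_fps
    by (simp add: wh_dagger_shift_fps add.commute flip: fls_times_fps_to_fls)
qed

text \<open>The binomial coefficients are real.\<close>

lemma wh_dagger_hbar_sqrt:
  assumes "weyl_dagger T = T"
  shows "wh_dagger (hbar_sqrt T) = hbar_sqrt T"
proof -
  have "weyl_dagger (T ^ k) = T ^ k" for k
    by (induction k) (simp_all add: weyl_dagger_1 weyl_dagger_simps assms power_commutes)
  moreover have "cnj ((1/2) gchoose k) = (1/2) gchoose k" for k
    by (simp add: gbinomial_prod_rev)
  ultimately show ?thesis
    unfolding hbar_sqrt_def hbar_series_def
    by (intro fls_eqI) (simp add: shift_one_mult weyl_dagger_simps)
qed

lemma wh_dagger_gens:
  "wh_dagger wh_a = wh_adag" "wh_dagger wh_adag = wh_a"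
  "wh_dagger (wh_aa Pl DPl) = - wh_aa Mi DMi" "wh_dagger (wh_aa Mi DMi) = - wh_aa Pl DPl"
  "wh_dagger (wh_aa Pl DMi) = wh_aa Mi DPl" "wh_dagger (wh_aa Mi DPl) = wh_aa Pl DMi"
  by (simp_all add: wh_a_def wh_adag_def wh_aa_def wh_dagger_const weyl_dagger_simps)

lemma wh_dagger_sqrt: "wh_dagger wh_sqrt = wh_sqrt"
  unfolding wh_sqrt_eq half_wn
  by (intro wh_dagger_hbar_sqrt)
    (simp add: wN_def weyl_dagger_simps weyl_dagger_uminus weyl_dagger_diff)

text \<open>The members of the eliminated pair, both equal to the selfadjoint \<open>S\<close>, follow the same rule as
  those of the three others.\<close>

lemma wh_dagger_ladder:
  "wh_dagger (ladder_up wh_sqrt A) = wh_scale (- index_sign A) (ladder_down wh_sqrt (conj_index A))"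
  "wh_dagger (ladder_down wh_sqrt A) = wh_scale (index_sign A) (ladder_up wh_sqrt (conj_index A))"
  by (cases A rule: conj_index.cases; simp add: wh_dagger_gens wh_dagger_sqrt wh_dagger_uminus wh.scale_minus_left)+

lemma wh_dagger_gen: "wh_dagger (wh_gen A B) = wh_scale (- index_sign A * index_sign B) (wh_gen (conj_index A) (conj_index B))"
  by (simp add: wh_gen_def wh_dagger_add wh_dagger_mult wh_dagger_ladder wh_scale_mult
    wh.scale_right_distrib wh.scale_right_diff_distrib mult.commute add.commute)

section \<open>Linear independence of the images\<close>

text \<open>The Fock representation, used to read off coefficients of elements of the Weyl algebra.\<close>

lift_definition weyl_op :: "weyl \<Rightarrow> fock \<Rightarrow> fock" is free_op
proof -
  fix x y :: free_alg
  assume "x - y \<in> weyl_ideal"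
  then have "free_op (x - y) f m p q = 0" for f m p q by (simp add: free_op_ideal)
  then show "free_op x = free_op y" by (simp add: free_op_diff fun_eq_iff)
qed

lemma weyl_op_simps:
  "weyl_op 0 f m p q = 0" "weyl_op 1 f = f"
  "weyl_op (x + y) f m p q = weyl_op x f m p q + weyl_op y f m p q"
  "weyl_op (x - y) f m p q = weyl_op x f m p q - weyl_op y f m p q"
  "weyl_op (- x) f m p q = - weyl_op x f m p q"
  "weyl_op (x * y) f = weyl_op x (weyl_op y f)"
  "weyl_op (weyl_scale c x) f m p q = c * weyl_op x f m p q"
  "weyl_op wa f = gen_op GenA f" "weyl_op wadag f = gen_op GenAdag f"
  "weyl_op (waa \<alpha> \<alpha>') f = gen_op (GenAA \<alpha> \<alpha>') f"
  by (transfer; simp add: free_op_add free_op_diff free_op_uminus free_op_mult free_op_1 free_op_gen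
    free_scale_def free_op_const)+

lemma wh_sqrt_nth:
  "fls_nth wh_sqrt (- 2) = 0" "fls_nth wh_sqrt (- 1) = 1" "fls_nth wh_sqrt 0 = 0"
  unfolding wh_sqrt_eq hbar_sqrt_def by (simp_all add: shift_one_mult hbar_series_def weyl_scale_1)

text \<open>One quantum in each mode: no generator annihilates this state, and different generators lead to
  different states.\<close>

definition fock_one :: fock where
  "fock_one = (\<lambda>m p q. if m = 1 \<and> p = 1 \<and> q = 1 then 1 else 0)"

text \<open>The coefficients of the series are examined in increasing degree. Symmetry of \<open>c\<close> accounts for
  the symmetry of \<open>wh_gen\<close>.\<close>

lemma wh_gen_independent:
  assumes sym: "\<And>A B. c A B = c B A"
    and zero: "(\<Sum>A\<in>UNIV. \<Sum>B\<in>UNIV. wh_scale (c A B) (wh_gen A B)) = 0"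
  shows "c A B = 0"
proof -
  define s where "s = (\<Sum>A\<in>UNIV. \<Sum>B\<in>UNIV. wh_scale (c A B) (wh_gen A B))"
  have coeff: "weyl_op (fls_nth s k) fock_one m p q = 0" for k m p q
    by (simp add: s_def zero weyl_op_simps)
  note expand = s_def UNIV_joint_index wh_gen_def wh_a_def wh_adag_def wh_aa_def wh_sqrt_square
    wh_inverse_hbar_def wh_sqrt_nth weyl_op_simps fock_one_def
  note order = sym[of "Inr DPl" "Inl _"] sym[of "Inr DMi" "Inl _"] sym[of "Inr DMi" "Inr DPl"]
    sym[of "Inl Mi" "Inl Pl"]
  \<comment> \<open>degree \<open>-2\<close>: the scalar part \<open>1/\<hbar>\<close> of the mixed component \<open>K\<close>\<close>
  have K: "c (Inr DPl) (Inr DMi) = 0"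
    using coeff[of "- 2" 1 1 1] by (simp add: expand order)
  \<comment> \<open>degree \<open>-1\<close>: a linear combination of the six generators, each moving one mode by one step\<close>
  have P: "c (Inr DPl) (Inr DPl) = 0" "c (Inr DMi) (Inr DMi) = 0"
    "c (Inl Pl) (Inr DPl) = 0" "c (Inl Pl) (Inr DMi) = 0"
    "c (Inl Mi) (Inr DPl) = 0" "c (Inl Mi) (Inr DMi) = 0"
    using coeff[of "- 1" 0 1 1] coeff[of "- 1" 2 1 1] coeff[of "- 1" 1 0 1] coeff[of "- 1" 1 2 1]
      coeff[of "- 1" 1 1 0] coeff[of "- 1" 1 1 2]
    by (simp_all add: expand order K)
  \<comment> \<open>degree \<open>0\<close>: what is left is quadratic in the \<open>a\<^sup>\<alpha>\<close>\<close>
  have J: "c (Inl Pl) (Inl Pl) = 0" "c (Inl Mi) (Inl Mi) = 0" "c (Inl Pl) (Inl Mi) = 0"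
    using coeff[of 0 1 2 2] coeff[of 0 1 0 0] coeff[of 0 1 1 1]
    by (simp_all add: expand order K P)
  show ?thesis
    using K P J by (cases A rule: conj_index.cases; cases B rule: conj_index.cases) (simp_all add: order)
qed

section \<open>The embedding\<close>

abbreviation wh_linear :: "(sp4 \<Rightarrow> weyl_h) \<Rightarrow> bool" where
  "wh_linear \<equiv> Vector_Spaces.linear scaleC wh_scale"

lemma wh_linear_iff: "wh_linear \<phi> \<longleftrightarrow>
  (\<forall>X Y. \<phi> (X + Y) = \<phi> X + \<phi> Y) \<and> (\<forall>c X. \<phi> (scaleC c X) = wh_scale c (\<phi> X))"
  by (simp add: Vector_Spaces.linear_iff sp4.vector_space_axioms wh.vector_space_axioms)

lemma given_on_basis_iff:
  "given_on_basis \<phi> \<longleftrightarrow> wh_linear \<phi> \<and> (\<forall>A B. \<phi> (sp4_gen A B) = wh_gen A B)"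
proof (cases "wh_linear \<phi>")
  case True
  then have scale: "\<phi> (scaleC c X) = wh_scale c (\<phi> X)" for c X by (simp add: wh_linear_iff)
  have uminus: "\<phi> (- X) = - \<phi> X" for X using scale[of "- 1" X] by simp
  have all: "(\<forall>A B :: joint_index. R A B) \<longleftrightarrow> (\<forall>\<alpha> \<beta>. R (Inl \<alpha>) (Inl \<beta>)) \<and> (\<forall>\<alpha> \<beta>. R (Inl \<alpha>) (Inr \<beta>))
    \<and> (\<forall>\<alpha> \<beta>. R (Inr \<alpha>) (Inl \<beta>)) \<and> (\<forall>\<alpha> \<beta>. R (Inr \<alpha>) (Inr \<beta>))" for R
    by (metis sum.exhaust)
  show ?thesis
    unfolding given_on_basis_def all by (auto simp: True scale uminus wh_gen_table)
qed (simp add: given_on_basis_def)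

definition wh_embed :: "sp4 \<Rightarrow> weyl_h" where
  "wh_embed X = (\<Sum>A\<in>UNIV. \<Sum>B\<in>UNIV. wh_scale (sp4_coord A B X) (wh_gen A B))"

lemma wh_embed_linear: "wh_linear wh_embed"
  by (simp add: wh_linear_iff wh_embed_def sp4_coord_linear wh.scale_left_distrib sum.distrib wh.scale_sum_right)

text \<open>A linear map is determined by its values on the generators, which gives uniqueness.\<close>

lemma linear_expand:
  assumes "wh_linear \<phi>"
  shows "\<phi> X = (\<Sum>A\<in>UNIV. \<Sum>B\<in>UNIV. wh_scale (sp4_coord A B X) (\<phi> (sp4_gen A B)))"
proof -
  interpret Vector_Spaces.linear scaleC wh_scale \<phi> by fact
  have "\<phi> X = \<phi> (\<Sum>A\<in>UNIV. \<Sum>B\<in>UNIV. scaleC (sp4_coord A B X) (sp4_gen A B))"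
    by (simp flip: sp4_expand)
  then show ?thesis by (simp add: sum scale)
qed

lemma sp4_coord_gen: "sp4_coord A B (sp4_gen C D) =
   ((if A = C \<and> B = D then 1 else 0) + (if A = D \<and> B = C then 1 else 0)) / 2"
  by (cases A rule: conj_index.cases; cases B rule: conj_index.cases; cases C rule: conj_index.cases; cases D rule: conj_index.cases)
    (simp_all add: sp4_comp_def entry_simps entry_J entry_K entry_P zero_quat_def complex_eq_iff del: sp4_J.simps sp4_K.simps sp4_P.simps)

lemma wh_embed_given_on_basis: "given_on_basis wh_embed"
proof -
  have half: "wh_scale (1/2) x + wh_scale (1/2) x = x" for x
    using wh.scale_left_distrib[of "1/2" "1/2" x] by simp
  have "wh_embed (sp4_gen C D) = wh_gen C D" for C D
    unfolding wh_embed_def sp4_coord_gen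
    by (cases C rule: conj_index.cases; cases D rule: conj_index.cases)
      (simp_all add: UNIV_joint_index half wh_gen_def add.commute)
  then show ?thesis by (simp add: given_on_basis_iff wh_embed_linear)
qed

lemma given_on_basis_eq:
  assumes "given_on_basis \<phi>"
  shows "\<phi> = wh_embed"
  using assms unfolding given_on_basis_iff
  by (intro ext) (simp add: linear_expand wh_embed_def)

lemma sp4_induct [case_names add scale basis]:
  assumes add: "\<And>X Y. P X \<Longrightarrow> P Y \<Longrightarrow> P (X + Y)"
    and scale: "\<And>c X. P X \<Longrightarrow> P (scaleC c X)"
    and basis: "\<And>A B. P (sp4_gen A B)"
  shows "P X"
proof -
  have zero: "P 0" using scale[OF basis, of 0] by simp
  have sum: "P (sum f S)" if "\<And>i. P (f i)" for f :: "joint_index \<Rightarrow> sp4" and S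
    by (induction S rule: infinite_finite_induct) (simp_all add: zero add that)
  show ?thesis
    by (subst sp4_expand) (intro sum scale basis)
qed

lemma sp4_bracket_simps:
  "sp4_bracket (X + Y) Z = sp4_bracket X Z + sp4_bracket Y Z"
  "sp4_bracket Z (X + Y) = sp4_bracket Z X + sp4_bracket Z Y"
  "sp4_bracket (scaleC k X) Z = scaleC k (sp4_bracket X Z)"
  "sp4_bracket Z (scaleC k X) = scaleC k (sp4_bracket Z X)"
  by (rule sp4_eqI; simp add: entry_bracket entry_simps complex_quat_times_def algebra_simps)+

lemma wh_embed_add: "wh_embed (X + Y) = wh_embed X + wh_embed Y"
  and wh_embed_scale: "wh_embed (scaleC c X) = wh_scale c (wh_embed X)"
  using wh_embed_linear by (simp_all add: wh_linear_iff)

lemma wh_embed_gen: "wh_embed (sp4_gen A B) = wh_gen A B"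
  using wh_embed_given_on_basis by (simp add: given_on_basis_iff)

lemma commutator_linear:
  "commutator (f + g) h = commutator f h + commutator g h"
  "commutator h (f + g) = commutator h f + commutator h g"
  "commutator (wh_scale c f) g = wh_scale c (commutator f g)"
  "commutator f (wh_scale c g) = wh_scale c (commutator f g)"
  by (simp_all add: commutator_def wh_scale_mult wh.scale_right_diff_distrib algebra_simps)

lemma wh_embed_bracket: "wh_embed (sp4_bracket X Y) = commutator (wh_embed X) (wh_embed Y)"
proof (induction X rule: sp4_induct)
  case (basis A B)
  show ?case
  proof (induction Y rule: sp4_induct)
    case (basis C D)
    show ?case by (simp add: sp4_gen_bracket wh_embed_add wh_embed_scale wh_embed_gen wh_gen_commutator)
  qed (simp_all add: sp4_bracket_simps wh_embed_add wh_embed_scale commutator_linear)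
qed (simp_all add: sp4_bracket_simps wh_embed_add wh_embed_scale commutator_linear)

lemma wh_embed_reality: "wh_embed (sp4_dagger X) = wh_dagger (wh_embed X)"
proof (induction X rule: sp4_induct)
  case (basis A B)
  show ?case by (simp only: sp4_dagger_gen wh_embed_scale wh_embed_gen wh_dagger_gen)
qed (simp_all add: sp4_dagger_add sp4_dagger_scaleC wh_embed_add wh_embed_scale wh_dagger_add wh_dagger_scale)

lemma inj_wh_embed: "inj wh_embed"
proof (rule injI)
  fix X Y assume "wh_embed X = wh_embed Y"
  then have "wh_embed (X + scaleC (- 1) Y) = 0"
    by (simp only: wh_embed_add wh_embed_scale) simp
  then have "sp4_coord A B (X + scaleC (- 1) Y) = 0" for A B
    unfolding wh_embed_def by (rule wh_gen_independent[OF sp4_coord_commute])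
  then have "X + scaleC (- 1) Y = 0"
    by (subst sp4_expand) simp
  then show "X = Y" by simp
qed

lemma u2H_embedding_wh_embed: "u2H_embedding (wh_embed \<circ> of_u2H)"
proof -
  have "vector_space (\<lambda>r. wh_scale (of_real r))"
    by unfold_locales (simp_all add: wh.scale_right_distrib wh.scale_left_distrib)
  moreover have "of_u2H (X + Y) = of_u2H X + of_u2H Y" for X Y
    by (simp add: of_u2H_def plus_complexified_def)
  moreover have "of_u2H (r *\<^sub>R X) = scaleC (of_real r) (of_u2H X)" for r X
    by (simp add: of_u2H_def scaleC_def)
  moreover have "of_u2H (u2H_bracket X Y) = sp4_bracket (of_u2H X) (of_u2H Y)" for X Y
  proof -
    have "u2H_bracket X 0 = 0" "u2H_bracket 0 X = 0" for X by (transfer; simp add: matrix_matrix_mult_def vec_eq_iff)+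
    then show ?thesis by (simp add: of_u2H_def sp4_bracket_def)
  qed
  moreover have "inj of_u2H" by (rule injI) (simp add: of_u2H_def)
  ultimately show ?thesis
    unfolding u2H_embedding_def Vector_Spaces.linear_iff
    by (auto simp: real_vector.vector_space_axioms wh_embed_add wh_embed_scale wh_embed_bracket
      intro: inj_compose inj_wh_embed)
qed

theorem theorem3p2:
  shows "(\<exists>!\<phi>. given_on_basis \<phi>) \<and>
    (\<forall>\<phi>. given_on_basis \<phi> \<longrightarrow>
      sp4_embedding \<phi> \<and> reality_preserving \<phi> \<and> u2H_embedding (\<phi> \<circ> of_u2H))"
proof -
  have "sp4_embedding wh_embed"
    by (simp add: sp4_embedding_def wh_embed_linear wh_embed_bracket inj_wh_embed)
  moreover have "reality_preserving wh_embed"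
    by (simp add: reality_preserving_def wh_embed_reality)
  ultimately show ?thesis
    using wh_embed_given_on_basis given_on_basis_eq u2H_embedding_wh_embed by blast
qed

end
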